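(* Let $P \in \mathbb{R}[x]$ be a polynomial whose coefficient of $x$ is non-Liouville. For a natural number $d$ and real $X > 0$ let $$\mathcal{A}_d(X) := \#\{x \in \mathbb{N} : x \le X,\ d \mid \gcd(x, \lfloor P(x) \rfloor)\}.$$ Then there exist constants $\mu, C, C_0 > 0$ such that for all natural numbers $d$ and all $X$ with $X/d > C$, $$\left|\mathcal{A}_d(X) - \frac{X}{d^2}\right| \le C_0 \left(\frac{X}{d}\right)^{1-\mu}.$$
   Context: A real number $\alpha$ is called Liouville if for every $n \in \mathbb{N}$ there exists a pair of integers $(p,q)$ with $q>1$ such that $\left|\alpha - \frac{p}{q}\right| \le q^{-n}$; it is non-Liouville if it is not Liouville. $\lfloor \cdot \rfloor$ denotes the floor function. *)

theory Defs
  imports Complex_Main "HOL-Computational_Algebra.Polynomial"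
begin

(* As p/q need not be in lowest terms and may equal \<alpha>, every rational number is
   Liouville in this sense; in particular 0 is. *)
definition liouville :: "real \<Rightarrow> bool" where
  "liouville \<alpha> \<longleftrightarrow>
     (\<forall>n::nat. \<exists>p q :: int. q > 1 \<and> \<bar>\<alpha> - of_int p / of_int q\<bar> \<le> 1 / of_int q ^ n)"

(* Natural numbers "x" are taken to be positive. The floor may be negative, so the gcd is
   taken in the integers (it is nonnegative there, and gcd x 0 = x for x > 0). *)
definition gcd_count :: "real poly \<Rightarrow> nat \<Rightarrow> real \<Rightarrow> nat" where
  "gcd_count P d X =
     card {x::nat. x \<ge> 1 \<and> real x \<le> X \<and> int d dvd gcd (int x) \<lfloor>poly P (real x)\<rfloor>}"

end

theory Submission
  imports Defs
begin

text \<open>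
  Writing \<open>x = d * y\<close> with \<open>y \<le> X / d\<close>, the condition \<open>d dvd \<lfloor>P x\<rfloor>\<close> says that the fractional part of
  \<open>Q y = P (d * y) / d\<close> is less than \<open>1 / d\<close>. The linear coefficient of \<open>Q\<close> is that of \<open>P\<close>, whatever
  \<open>d\<close> is, so it suffices to prove equidistribution with a power saving, uniform over all polynomials
  of bounded degree with a given non-Liouville linear coefficient \<open>\<alpha>\<close>. If an exponential sum of such a
  polynomial over \<open>N\<close> terms is as large as \<open>N / K\<close>, then van der Corput differencing and Vinogradov's
  lemma give a good rational approximation, with denominator at most a power of \<open>K\<close>, to the top
  coefficient. The top term can then be removed by partial summation and a Fourier expansion modulo the
  denominator, so by induction on the degree \<open>\<alpha>\<close> itself has a good rational approximation. As \<open>\<alpha>\<close> is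
  not Liouville, this is impossible when \<open>K\<close> is a small power of \<open>N\<close>. Fejer kernels convert the
  bounds on exponential sums into a bound on the discrepancy.
\<close>

section \<open>Exponential sums\<close>

definition ee :: "real \<Rightarrow> complex" where
  "ee x = cis (2 * pi * x)"

lemma ee_add: "ee (x + y) = ee x * ee y"
  by (simp add: ee_def cis_mult distrib_left)

lemma norm_ee [simp]: "norm (ee x) = 1"
  by (simp add: ee_def)

lemma ee_0 [simp]: "ee 0 = 1"
  by (simp add: ee_def)

lemma ee_of_int [simp]: "ee (of_int n) = 1"
  by (simp add: ee_def cis.ctr complex_eq_iff sin_int_2pin cos_int_2pin)

lemma cnj_ee: "cnj (ee x) = ee (- x)"
  by (simp add: ee_def cis_cnj)

lemma ee_power: "ee (real n * x) = ee x ^ n"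
  by (induction n) (simp_all add: ee_add distrib_right)

lemma ee_add_int [simp]: "ee (x + of_int n) = ee x"
  by (simp add: ee_add)

section \<open>Geometric sums and the distance to the nearest integer\<close>

lemma sin_ge_half:
  assumes "0 \<le> u" "u \<le> pi / 2"
  shows "u / 2 \<le> sin u"
proof (cases "u = 0")
  case False
  define v where "v = u / 2"
  have v: "0 < v" "v \<le> pi / 4" using assms False by (auto simp: v_def)
  \<comment> \<open>The half angle \<open>v\<close> is at most pi / 4, where cosines are at least
    sqrt 2 / 2, so sin u = 2 sin v cos v loses at most a factor 2. The constant 1/2 is weaker than
    Jordan's 2/pi but suffices.\<close>
  obtain z where z: "0 < z" "z < v" "sin v - sin 0 = (v - 0) * cos z"
    using MVT2[of 0 v sin cos] v by (auto intro: DERIV_sin)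
  have c: "cos (pi / 4) \<le> cos v" using v by (intro cos_monotone_0_pi_le) auto
  have cz: "cos v \<le> cos z" using v z by (intro cos_monotone_0_pi_le) auto
  have c0: "sqrt 2 / 2 \<le> cos v" using c by (simp add: cos_45)
  have "0 \<le> cos v" using c0 by (rule order.trans[rotated]) simp
  have "1 / 2 = (sqrt 2 / 2) * (sqrt 2 / 2)" by simp
  also have "\<dots> \<le> cos z * cos v" using c0 cz \<open>0 \<le> cos v\<close> by (intro mult_mono) auto
  finally have "v * (1 / 2) \<le> v * (cos z * cos v)" using v by (intro mult_left_mono) auto
  moreover have "sin u = 2 * (v * (cos z * cos v))"
    using sin_double[of v] z(3) by (simp add: v_def)
  moreover have "u / 2 = 2 * (v * (1 / 2))" by (simp add: v_def)
  ultimately show ?thesis by linarith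
qed simp

lemma norm_one_minus_ee: "norm (1 - ee x) = 2 * \<bar>sin (pi * x)\<bar>"
proof -
  have "(norm (1 - ee x))\<^sup>2 = (2 * \<bar>sin (pi * x)\<bar>)\<^sup>2"
  proof -
    have "cos (2 * (pi * x)) = 1 - 2 * (sin (pi * x))\<^sup>2"
      by (rule cos_double_sin)
    moreover have "(norm (1 - ee x))\<^sup>2 = 2 - 2 * cos (2 * pi * x)"
      using sin_cos_squared_add[of "2 * pi * x"]
      unfolding cmod_power2 by (simp add: ee_def power2_eq_square algebra_simps)
    ultimately show ?thesis by (simp add: power_mult_distrib algebra_simps)
  qed
  thus ?thesis by (subst (asm) power2_eq_iff_nonneg) auto
qed

text \<open>By periodicity \<open>x\<close> may be replaced by its signed distance to the nearest
  integer, which is at most 1/2 in absolute value and so keeps the angle in the range of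
  \<open>sin_ge_half\<close>.\<close>

lemma norm_one_minus_ee_ge: "2 * \<bar>x - of_int (round x)\<bar> \<le> norm (1 - ee x)"
proof -
  define t where "t = x - of_int (round x)"
  have t: "\<bar>t\<bar> \<le> 1 / 2" using of_int_round_abs_le[of x] by (simp add: t_def abs_minus_commute)
  have "ee x = ee t"
    using ee_add_int[of t "round x"] by (simp add: t_def)
  hence "norm (1 - ee x) = 2 * \<bar>sin (pi * t)\<bar>" by (simp add: norm_one_minus_ee)
  moreover have "\<bar>sin (pi * t)\<bar> = \<bar>sin (pi * \<bar>t\<bar>)\<bar>" by (cases "t \<ge> 0") auto
  moreover have "pi * \<bar>t\<bar> / 2 \<le> sin (pi * \<bar>t\<bar>)"
    using t by (intro sin_ge_half) (auto simp: field_simps)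
  moreover have "2 * \<bar>t\<bar> \<le> pi * \<bar>t\<bar>" using pi_ge_two by (intro mult_right_mono) auto
  ultimately show ?thesis unfolding t_def[symmetric] by linarith
qed

text \<open>The geometric sum bound, multiplied out so that it also holds at integral
  \<open>x\<close>, where the distance vanishes.\<close>

lemma norm_sum_ee_le:
  "norm (\<Sum>y<M. ee (real y * x)) * \<bar>x - of_int (round x)\<bar> \<le> 1"
proof -
  have "(1 - ee x) * (\<Sum>y<M. ee (real y * x)) = 1 - ee x ^ M"
    by (simp add: ee_power one_diff_power_eq)
  hence "norm (1 - ee x) * norm (\<Sum>y<M. ee (real y * x)) = norm (1 - ee x ^ M)"
    by (metis norm_mult)
  also have "\<dots> \<le> 1 + 1" using norm_triangle_ineq4[of 1 "ee x ^ M"] by (simp add: norm_power)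
  finally have "norm (1 - ee x) * norm (\<Sum>y<M. ee (real y * x)) \<le> 2" by simp
  moreover have "2 * \<bar>x - of_int (round x)\<bar> * norm (\<Sum>y<M. ee (real y * x))
      \<le> norm (1 - ee x) * norm (\<Sum>y<M. ee (real y * x))"
    by (intro mult_right_mono norm_one_minus_ee_ge) auto
  ultimately show ?thesis by (simp add: mult_ac)
qed

section \<open>Fourier analysis on the residues modulo q\<close>

lemma sum_ee_orthogonal:
  assumes "0 < q"
  shows "(\<Sum>j<q. ee (real j * of_int n / real q)) = (if int q dvd n then of_nat q else 0)"
proof (cases "int q dvd n")
  case True
  then obtain k where k: "n = int q * k" by auto
  have "real j * of_int n / real q = of_int (int j * k)" for j
    using assms by (simp add: k)
  hence "ee (real j * of_int n / real q) = 1" for j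
    by (metis ee_of_int)
  thus ?thesis using True by simp
next
  case False
  define x where "x = of_int n / real q"
  have "x \<noteq> of_int m" for m
  proof
    assume "x = of_int m"
    hence "of_int n = (of_int (m * int q) :: real)" using assms by (simp add: x_def field_simps)
    hence "n = m * int q" by (simp only: of_int_eq_iff)
    thus False using False by simp
  qed
  hence "0 < \<bar>x - of_int (round x)\<bar>" by simp
  \<comment> \<open>When \<open>q\<close> does not divide \<open>n\<close>, \<open>ee x\<close> is a
    nontrivial \<open>q\<close>-th root of unity, so its geometric sum vanishes.\<close>
  hence nz: "ee x \<noteq> 1" using norm_one_minus_ee_ge[of x] by auto
  have "ee x ^ q = ee (of_int n)" using assms by (simp add: ee_power[symmetric] x_def del: ee_of_int)
  hence "(1 - ee x) * (\<Sum>j<q. ee x ^ j) = 0" by (simp add: one_diff_power_eq[symmetric])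
  hence "(\<Sum>j<q. ee x ^ j) = 0" using nz by simp
  moreover have "ee (real j * of_int n / real q) = ee x ^ j" for j
    by (simp add: ee_power[symmetric] x_def)
  ultimately show ?thesis using False by simp
qed

text \<open>Discrete Fourier inversion. Only the trivial bound on the coefficients is kept: the
  resulting loss of a factor \<open>q\<close> is affordable because \<open>q\<close> will be bounded
  by a power of \<open>K\<close>.\<close>

lemma finite_Fourier_expansion:
  fixes g :: "nat \<Rightarrow> complex"
  assumes q: "0 < q" and per: "\<And>y. g (y mod q) = g y" and g1: "\<And>y. norm (g y) \<le> 1"
  obtains c :: "nat \<Rightarrow> complex"
  where "\<And>j. norm (c j) \<le> 1" "\<And>y. g y = (\<Sum>j<q. c j * ee (real j * real y / real q))"
proof
  define c where "c j = (\<Sum>r<q. g r * ee (- (real j * real r / real q))) / of_nat q" for j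
  show "norm (c j) \<le> 1" for j
  proof -
    have "norm (\<Sum>r<q. g r * ee (- (real j * real r / real q))) \<le> (\<Sum>r<q. 1)"
      by (intro sum_norm_le) (simp add: norm_mult g1)
    thus ?thesis using q by (simp add: c_def norm_divide)
  qed
  show "g y = (\<Sum>j<q. c j * ee (real j * real y / real q))" for y
  proof -
    have 1: "(\<Sum>j<q. ee (real j * of_int (int y - int r) / real q))
        = (if r = y mod q then of_nat q else 0)" if "r < q" for r
    proof -
      have "int q dvd int y - int r \<longleftrightarrow> r = y mod q"
        using that by (metis mod_eq_dvd_iff mod_less of_nat_eq_iff zmod_int)
      thus ?thesis using sum_ee_orthogonal[OF q, of "int y - int r"] by simp
    qed
    have "(\<Sum>j<q. c j * ee (real j * real y / real q))
        = (\<Sum>j<q. \<Sum>r<q. g r * ee (real j * of_int (int y - int r) / real q)) / of_nat q"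
    proof -
      have "ee (- (real j * real r / real q)) * ee (real j * real y / real q)
          = ee (real j * of_int (int y - int r) / real q)" for j r
        by (simp add: ee_add[symmetric] right_diff_distrib diff_divide_distrib)
      thus ?thesis
        by (simp add: c_def sum_divide_distrib sum_distrib_right mult.assoc)
    qed
    also have "(\<Sum>j<q. \<Sum>r<q. g r * ee (real j * of_int (int y - int r) / real q))
        = (\<Sum>r<q. g r * (\<Sum>j<q. ee (real j * of_int (int y - int r) / real q)))"
      by (subst sum.swap) (simp add: sum_distrib_left)
    also have "\<dots> = (\<Sum>r<q. if r = y mod q then g r * of_nat q else 0)"
      by (intro sum.cong refl) (use 1 in auto)
    also have "\<dots> = g y * of_nat q" using q by (simp add: per)
    finally show ?thesis using q by simp
  qed
qed

text \<open>Van der Corput differencing: expand the square and group the pairs by their difference.\<close>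

lemma norm_sum_square_eq:
  fixes f :: "nat \<Rightarrow> complex"
  shows "(norm (\<Sum>y<M. f y))\<^sup>2 = (\<Sum>y<M. (norm (f y))\<^sup>2)
    + 2 * Re (\<Sum>h\<in>{1..M}. \<Sum>y<M - h. f (y + h) * cnj (f y))"
proof (induction M)
  case (Suc M)
  define S where "S = (\<Sum>y<M. f y)"
  have exp: "(norm (a + b))\<^sup>2 = (norm a)\<^sup>2 + (norm b)\<^sup>2 + 2 * Re (b * cnj a)" for a b :: complex
    unfolding cmod_power2 by (simp add: power2_eq_square algebra_simps)
  \<comment> \<open>The difference \<open>Suc M\<close> contributes an empty sum, and each smaller
    \<open>h\<close> gains exactly the pair formed by the new index \<open>M\<close> and
    \<open>M - h\<close>.\<close>
  have "(\<Sum>h\<in>{1..Suc M}. \<Sum>y<Suc M - h. f (y + h) * cnj (f y))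
      = (\<Sum>h\<in>{1..M}. \<Sum>y<Suc M - h. f (y + h) * cnj (f y))" by simp
  also have "\<dots> = (\<Sum>h\<in>{1..M}. (\<Sum>y<M - h. f (y + h) * cnj (f y)) + f M * cnj (f (M - h)))"
    by (intro sum.cong refl) (simp add: Suc_diff_le)
  also have "\<dots> = (\<Sum>h\<in>{1..M}. \<Sum>y<M - h. f (y + h) * cnj (f y)) + f M * cnj (\<Sum>h\<in>{1..M}. f (M - h))"
    by (simp add: sum.distrib sum_distrib_left)
  also have "(\<Sum>h\<in>{1..M}. f (M - h)) = S"
    unfolding S_def by (rule sum.reindex_bij_witness[of _ "\<lambda>y. M - y" "\<lambda>h. M - h"]) auto
  finally show ?case using Suc exp[of S "f M"] by (simp add: S_def)
qed simp

section \<open>Vinogradov's lemma\<close>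

text \<open>Compare with the interval from the minimum to the maximum. The condition
  \<open>a \<le> b + 1\<close> keeps the bound nonnegative when \<open>A\<close> is empty.\<close>

lemma card_nat_interval_le:
  fixes a b :: real
  assumes "finite A" "\<And>i. i \<in> A \<Longrightarrow> a \<le> real i \<and> real i \<le> b" "a \<le> b + 1"
  shows "real (card A) \<le> b - a + 1"
proof (cases "A = {}")
  case False
  have "Max A \<in> A" "Min A \<in> A" using assms(1) False by auto
  hence "real (Max A) \<le> b" "a \<le> real (Min A)" "Min A \<le> Max A" using assms by auto
  moreover have "card A \<le> card {Min A..Max A}"
    using assms(1) by (intro card_mono) auto
  ultimately show ?thesis by (auto simp: of_nat_diff)
qed (use assms in simp)

lemma card_int_interval_le:
  fixes a b :: real
  assumes "finite A" "\<And>i. i \<in> A \<Longrightarrow> a \<le> of_int i \<and> of_int i \<le> b" "a \<le> b + 1"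
  shows "real (card A) \<le> b - a + 1"
proof (cases "A = {}")
  case False
  have "Max A \<in> A" "Min A \<in> A" using assms(1) False by auto
  hence *: "of_int (Max A) \<le> b" "a \<le> of_int (Min A)" "Min A \<le> Max A" using assms by auto
  moreover have "card A \<le> card {Min A..Max A}"
    using assms(1) by (intro card_mono) auto
  ultimately have "real (card A) \<le> real (nat (Max A - Min A + 1))" by simp
  thus ?thesis using * by simp
qed (use assms in simp)

lemma card_le_card_image_times:
  fixes c :: real
  assumes "finite A" "\<And>b. b \<in> f ` A \<Longrightarrow> real (card {a \<in> A. f a = b}) \<le> c"
  shows "real (card A) \<le> real (card (f ` A)) * c"
proof -
  have "card A = (\<Sum>b\<in>f ` A. card {a \<in> A. f a = b})"
    using sum.group[of A "f ` A" f "\<lambda>_. 1::nat"] assms(1) by simp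
  hence "real (card A) = (\<Sum>b\<in>f ` A. real (card {a \<in> A. f a = b}))" by simp
  also have "\<dots> \<le> (\<Sum>b\<in>f ` A. c)" by (intro sum_mono assms(2))
  finally show ?thesis by simp
qed

text \<open>For slowly varying \<open>c + t * \<theta>\<close> the points close to a fixed integer form a
  short block, and only few integers are approached.\<close>

lemma card_near_integers_le:
  fixes T :: "nat set" and c \<theta> \<epsilon> :: real
  assumes T: "T \<subseteq> {..N}" and \<theta>: "\<theta> \<noteq> 0" and \<epsilon>: "0 \<le> \<epsilon>" "2 * \<epsilon> \<le> 1"
    and near: "\<And>t. t \<in> T \<Longrightarrow> \<exists>n::int. \<bar>c + real t * \<theta> - of_int n\<bar> \<le> \<epsilon>"
  shows "real (card T) \<le> (\<bar>\<theta>\<bar> * real N + 2) * (2 * \<epsilon> / \<bar>\<theta>\<bar> + 1)"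
proof -
  have fin: "finite T" using T by (rule finite_subset) simp
  obtain n where n: "\<And>t. t \<in> T \<Longrightarrow> \<bar>c + real t * \<theta> - of_int (n t)\<bar> \<le> \<epsilon>"
    using near by metis
  \<comment> \<open>The least value of \<open>c + t * \<theta>\<close> for real \<open>t\<close> in
    [0, N], whatever the sign of \<open>\<theta>\<close>.\<close>
  define lo where "lo = c + min 0 (real N * \<theta>)"
  have "real (card (n ` T)) \<le> (lo + \<bar>\<theta>\<bar> * real N + \<epsilon>) - (lo - \<epsilon>) + 1"
  proof (rule card_int_interval_le)
    show "lo - \<epsilon> \<le> of_int i \<and> of_int i \<le> lo + \<bar>\<theta>\<bar> * real N + \<epsilon>" if "i \<in> n ` T" for i
    proof -
      obtain t where t: "t \<in> T" "i = n t" using \<open>i \<in> n ` T\<close> by auto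
      have tN: "real t \<le> real N" using t T by auto
      have "\<bar>c + real t * \<theta> - of_int i\<bar> \<le> \<epsilon>" using n t by auto
      moreover have "min 0 (real N * \<theta>) \<le> real t * \<theta> \<and> real t * \<theta> \<le> min 0 (real N * \<theta>) + \<bar>\<theta>\<bar> * real N"
      proof (cases "\<theta> \<ge> 0")
        case True
        have "real t * \<theta> \<le> real N * \<theta>" using tN True by (rule mult_right_mono)
        moreover have "0 \<le> real t * \<theta>" using True by simp
        ultimately show ?thesis using True by (simp add: mult.commute)
      next
        case False
        have "real N * \<theta> \<le> real t * \<theta>" using tN False by (intro mult_right_mono_neg) auto
        moreover have "real t * \<theta> \<le> 0" using False by (simp add: mult_le_0_iff)
        moreover have "min 0 (real N * \<theta>) = real N * \<theta>" "\<bar>\<theta>\<bar> * real N = - (real N * \<theta>)"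
          using False by (simp_all add: mult_nonneg_nonpos)
        ultimately show ?thesis by linarith
      qed
      ultimately show ?thesis by (simp add: lo_def) linarith
    qed
  qed (use fin \<epsilon> in auto)
  hence 1: "real (card (n ` T)) \<le> \<bar>\<theta>\<bar> * real N + 2" using \<epsilon> by simp
  have 2: "real (card {t \<in> T. n t = b}) \<le> 2 * \<epsilon> / \<bar>\<theta>\<bar> + 1" for b
  proof -
    define u w where "u = (of_int b - c) / \<theta>" and "w = \<epsilon> / \<bar>\<theta>\<bar>"
    have w: "0 \<le> w" using \<epsilon> by (simp add: w_def)
    have "real (card {t \<in> T. n t = b}) \<le> (u + w) - (u - w) + 1"
    proof (rule card_nat_interval_le)
      show "u - w \<le> real t \<and> real t \<le> u + w" if "t \<in> {t \<in> T. n t = b}" for t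
      proof -
        have "(c + real t * \<theta> - of_int b) / \<theta> = real t - u"
          using \<theta> by (simp add: u_def diff_divide_distrib add_divide_distrib)
        hence "\<bar>real t - u\<bar> = \<bar>c + real t * \<theta> - of_int b\<bar> / \<bar>\<theta>\<bar>"
          by (metis abs_divide)
        also have "\<dots> \<le> w"
          unfolding w_def using n that by (intro divide_right_mono) auto
        finally show ?thesis by linarith
      qed
    qed (use fin w in auto)
    thus ?thesis by (simp add: w_def)
  qed
  have "real (card T) \<le> real (card (n ` T)) * (2 * \<epsilon> / \<bar>\<theta>\<bar> + 1)"
    by (rule card_le_card_image_times[OF fin 2])
  also have "\<dots> \<le> (\<bar>\<theta>\<bar> * real N + 2) * (2 * \<epsilon> / \<bar>\<theta>\<bar> + 1)"
    using 1 \<epsilon> by (intro mult_right_mono) auto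
  finally show ?thesis .
qed

text \<open>Pigeonhole on blocks of length floor(2K): there are fewer blocks than elements of
  \<open>A\<close>, so two elements share a block.\<close>

lemma exists_close_pair:
  fixes A :: "nat set" and K :: real
  assumes A: "A \<subseteq> {1..N}" and K: "2 \<le> K" and card: "real N \<le> K * real (card A)"
    and N: "16 * K\<^sup>2 \<le> real N"
  obtains h q where "h \<in> A" "h + q \<in> A" "1 \<le> q" "real q \<le> 2 * K"
proof -
  define L where "L = nat \<lfloor>2 * K\<rfloor>"
  have L: "2 * K - 1 \<le> real L" "real L \<le> 2 * K" "1 \<le> L"
    using K unfolding L_def by linarith+
  have fin: "finite A" using A by (rule finite_subset) simp
  have "\<not> inj_on (\<lambda>h. h div L) A"
  proof (rule pigeonhole)
    have "real (card ((\<lambda>h. h div L) ` A)) \<le> real N / real L - 0 + 1"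
    proof (rule card_nat_interval_le)
      show "0 \<le> real i \<and> real i \<le> real N / real L" if "i \<in> (\<lambda>h. h div L) ` A" for i
      proof -
        obtain h where h: "h \<in> A" "i = h div L" using \<open>i \<in> _\<close> by blast
        have "real i \<le> real h / real L" using h by (simp add: of_nat_div_le_of_nat)
        also have "\<dots> \<le> real N / real L" using h A by (intro divide_right_mono) auto
        finally show ?thesis by simp
      qed
    qed (use fin in \<open>auto simp: add_nonneg_nonneg\<close>)
    \<comment> \<open>Since \<open>K \<ge> 2\<close>, \<open>L\<close> is at least 3K/2, so the
      first term is at most two thirds of N/K; the size of \<open>N\<close> makes the added 1 less
      than the remaining third.\<close>
    also have "\<dots> < real N / K"
    proof -
      have "real N / real L \<le> real N / (3 / 2 * K)"
        using K L by (intro divide_left_mono) auto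
      moreover have "1 < real N / K / 3"
      proof -
        have "3 * K < K * (16 * K)" using K by simp
        also have "\<dots> \<le> real N" using N by (simp add: power2_eq_square mult_ac)
        finally show ?thesis using K by (simp add: field_simps)
      qed
      ultimately show ?thesis by (simp add: field_simps)
    qed
    also have "\<dots> \<le> real (card A)" using card K by (simp add: field_simps)
    finally show "card ((\<lambda>h. h div L) ` A) < card A" by simp
  qed
  then obtain a b where ab: "a \<in> A" "b \<in> A" "a div L = b div L" "a < b"
    unfolding inj_on_def by (metis linorder_neqE_nat)
  have "b = a div L * L + b mod L" using ab(3) by simp
  moreover have "a div L * L \<le> a" by simp
  moreover have "b mod L < L" using L(3) by simp
  ultimately have "b < a + L" by linarith
  hence "real (b - a) \<le> 2 * K" using L ab by linarith
  thus ?thesis using that[of a "b - a"] ab by auto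
qed

text \<open>Two close elements give a denominator \<open>q\<close> with \<open>q * \<beta>\<close> within
  \<open>2 * \<epsilon>\<close> of an integer; along residue classes mod \<open>q\<close> the sequence \<open>h * \<beta>\<close> drifts
  slowly, and the density of \<open>A\<close> bounds this drift.\<close>

lemma Vinogradov_recurrence:
  fixes A :: "nat set" and \<beta> \<epsilon> K :: real
  assumes A: "A \<subseteq> {1..N}" and K: "2 \<le> K" and card: "real N \<le> K * real (card A)"
    and \<epsilon>: "0 \<le> \<epsilon>" "32 * K\<^sup>2 * \<epsilon> \<le> 1" and N: "16 * K\<^sup>2 \<le> real N"
    and near: "\<And>h. h \<in> A \<Longrightarrow> \<exists>m::int. \<bar>real h * \<beta> - of_int m\<bar> \<le> \<epsilon>"
  obtains q :: nat and m :: int where "1 \<le> q" "real q \<le> 2 * K"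
    "\<bar>real q * \<beta> - of_int m\<bar> \<le> 16 * K\<^sup>2 * \<epsilon> / real N"
proof -
  have fin: "finite A" using A by (rule finite_subset) simp
  have K2: "4 \<le> K\<^sup>2" using power_mono[OF K, of 2] by simp
  have N0: "0 < real N" using N K2 by linarith
  obtain h q where hq: "h \<in> A" "h + q \<in> A" "1 \<le> q" "real q \<le> 2 * K"
    using exists_close_pair[OF A K card N] by blast
  obtain m1 where m1: "\<bar>real h * \<beta> - of_int m1\<bar> \<le> \<epsilon>" using near hq(1) by blast
  obtain m2 where m2: "\<bar>real (h + q) * \<beta> - of_int m2\<bar> \<le> \<epsilon>" using near hq(2) by blast
  define m where "m = m2 - m1"
  define \<theta> where "\<theta> = real q * \<beta> - of_int m"
  have "\<theta> = (real (h + q) * \<beta> - of_int m2) - (real h * \<beta> - of_int m1)"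
    by (simp add: \<theta>_def m_def algebra_simps)
  hence \<theta>2: "\<bar>\<theta>\<bar> \<le> 2 * \<epsilon>" using m1 m2 by linarith
  have \<epsilon>1: "2 * \<epsilon> \<le> 1"
  proof -
    have "2 * \<epsilon> \<le> (32 * K\<^sup>2) * \<epsilon>" using K2 \<epsilon> by (intro mult_right_mono) auto
    thus ?thesis using \<epsilon> by linarith
  qed
  have "\<bar>\<theta>\<bar> \<le> 16 * K\<^sup>2 * \<epsilon> / real N"
  proof (cases "\<theta> = 0")
    case False
    define B where "B = (\<bar>\<theta>\<bar> * real N + 2) * (2 * \<epsilon> / \<bar>\<theta>\<bar> + 1)"
    have B0: "0 \<le> B" using \<epsilon> by (simp add: B_def)
    have "real (card A) \<le> real (card ((\<lambda>h. h mod q) ` A)) * B"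
    proof (rule card_le_card_image_times[OF fin])
      fix r assume "r \<in> (\<lambda>h. h mod q) ` A"
      \<comment> \<open>The quotients \<open>t\<close> of the elements \<open>t * q + r\<close> of
        \<open>A\<close> in one residue class; along them \<open>h * \<beta>\<close> equals
        \<open>r * \<beta> + t * \<theta>\<close> up to an integer.\<close>
      define T where "T = (\<lambda>h. h div q) ` {h \<in> A. h mod q = r}"
      have "inj_on (\<lambda>h. h div q) {h \<in> A. h mod q = r}"
        by (rule inj_onI) (metis (mono_tags, lifting) div_mult_mod_eq mem_Collect_eq)
      hence "card {h \<in> A. h mod q = r} = card T" by (simp add: T_def card_image)
      moreover have "real (card T) \<le> B" unfolding B_def
      proof (rule card_near_integers_le)
        show "T \<subseteq> {..N}"
        proof
          fix t assume "t \<in> T"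
          then obtain h where "h \<in> A" "t = h div q" by (auto simp: T_def)
          thus "t \<in> {..N}" using A div_le_dividend[of h q] by (force simp del: div_le_dividend)
        qed
        show "\<exists>n::int. \<bar>real r * \<beta> + real t * \<theta> - of_int n\<bar> \<le> \<epsilon>" if "t \<in> T" for t
        proof -
          have tA: "t * q + r \<in> A" using that by (auto simp: T_def)
          then obtain k where "\<bar>real (t * q + r) * \<beta> - of_int k\<bar> \<le> \<epsilon>" using near by blast
          hence "\<bar>real r * \<beta> + real t * \<theta> - of_int (k - int t * m)\<bar> \<le> \<epsilon>"
            by (simp add: \<theta>_def algebra_simps)
          thus ?thesis by blast
        qed
      qed (use False \<epsilon> \<epsilon>1 in auto)
      ultimately show "real (card {h \<in> A. h mod q = r}) \<le> B" by simp
    qed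
    also have "\<dots> \<le> (2 * K) * B"
    proof (intro mult_right_mono B0)
      have "card ((\<lambda>h. h mod q) ` A) \<le> card {..<q}"
        using hq by (intro card_mono) auto
      thus "real (card ((\<lambda>h. h mod q) ` A)) \<le> 2 * K" using hq by simp
    qed
    finally have "real (card A) \<le> 2 * K * B" .
    hence "K * real (card A) \<le> K * (2 * K * B)" using K by (intro mult_left_mono) auto
    hence "real N \<le> 2 * K\<^sup>2 * B" using card by (simp add: power2_eq_square mult_ac)
    \<comment> \<open>After expansion, the hypotheses on \<open>\<epsilon>\<close> and
      \<open>N\<close> bound all terms but the one with \<open>\<bar>\<theta>\<bar>\<close> in the
      denominator by N/2 in total. That term is thus at least N/2, which bounds
      \<open>\<theta>\<close>.\<close>
    also have "B = 2 * \<epsilon> * real N + \<bar>\<theta>\<bar> * real N + 4 * \<epsilon> / \<bar>\<theta>\<bar> + 2"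
      using False by (simp add: B_def field_simps)
    also have "2 * K\<^sup>2 * \<dots> \<le> 2 * K\<^sup>2 * (4 * \<epsilon> * real N + 4 * \<epsilon> / \<bar>\<theta>\<bar> + 2)"
    proof (intro mult_left_mono)
      have "\<bar>\<theta>\<bar> * real N \<le> 2 * \<epsilon> * real N" using \<theta>2 by (intro mult_right_mono) auto
      thus "2 * \<epsilon> * real N + \<bar>\<theta>\<bar> * real N + 4 * \<epsilon> / \<bar>\<theta>\<bar> + 2 \<le> 4 * \<epsilon> * real N + 4 * \<epsilon> / \<bar>\<theta>\<bar> + 2"
        by simp
    qed simp
    also have "\<dots> = (32 * K\<^sup>2 * \<epsilon>) * real N / 4 + 8 * K\<^sup>2 * \<epsilon> / \<bar>\<theta>\<bar> + (16 * K\<^sup>2) / 4"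
      by (simp add: algebra_simps)
    also have "\<dots> \<le> 1 * real N / 4 + 8 * K\<^sup>2 * \<epsilon> / \<bar>\<theta>\<bar> + real N / 4"
      using \<epsilon> N by (intro add_mono divide_right_mono mult_right_mono) auto
    finally have "real N / 2 \<le> 8 * K\<^sup>2 * \<epsilon> / \<bar>\<theta>\<bar>" by simp
    thus ?thesis using False N0 by (simp add: field_simps)
  qed (use \<epsilon> in simp)
  thus ?thesis using that hq unfolding \<theta>_def by blast
qed

section \<open>The top coefficient\<close>

lemma difference_poly:
  fixes Q :: "real poly" and h :: real
  assumes "degree Q \<le> Suc k"
  defines "R \<equiv> pcompose Q [:h, 1:] - Q"
  shows "degree R \<le> k" "coeff R k = real (Suc k) * h * coeff Q (Suc k)"
proof -
  \<comment> \<open>Stated for all \<open>k\<close>, because the induction strips a coefficient and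
    lowers the degree bound; vanishing coefficients are easier to carry than a degree.\<close>
  have "(\<forall>i>k. coeff (pcompose Q [:h, 1:] - Q) i = 0) \<and>
     coeff (pcompose Q [:h, 1:] - Q) k = real (Suc k) * h * coeff Q (Suc k)"
    if "degree Q \<le> Suc k" for Q :: "real poly" and k
    using that
  proof (induction Q arbitrary: k)
    case (pCons a Q)
    define R where "R = pcompose Q [:h, 1:] - Q"
    \<comment> \<open>A discrete product rule for x * Q(x); the constant \<open>a\<close>
      cancels.\<close>
    have eq: "pcompose (pCons a Q) [:h, 1:] - pCons a Q = smult h R + smult h Q + pCons 0 R"
    proof -
      have "pcompose (pCons a Q) [:h, 1:] - pCons a Q
          = [:a:] + [:h, 1:] * (R + Q) - ([:a:] + pCons 0 Q)"
        by (simp add: pcompose_pCons R_def)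
      also have "\<dots> = smult h R + smult h Q + pCons 0 R"
        by (simp add: smult_add_right)
      finally show ?thesis .
    qed
    have deg: "degree Q \<le> k" using pCons by (cases "Q = 0") auto
    show ?case
    proof (cases k)
      case 0
      then obtain c where "Q = [:c:]" using deg degree_eq_zeroE by auto
      hence "R = 0" "Q = [:c:]" by (simp_all add: R_def)
      thus ?thesis unfolding eq by (auto simp: 0 coeff_pCons split: nat.splits)
    next
      case (Suc l)
      have IH: "\<forall>i>l. coeff R i = 0" "coeff R l = real (Suc l) * h * coeff Q (Suc l)"
        using pCons.IH[of l] deg Suc by (auto simp: R_def)
      have "coeff Q i = 0" if "i > k" for i using deg that by (simp add: coeff_eq_0)
      thus ?thesis using IH unfolding eq
        by (auto simp: Suc coeff_pCons algebra_simps split: nat.splits)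
    qed
  qed simp
  from this[OF assms(1)] show "degree R \<le> k" "coeff R k = real (Suc k) * h * coeff Q (Suc k)"
    unfolding R_def by (auto intro: degree_le)
qed

text \<open>In the differenced square the diagonal gives at most N, the correlations below N /
  (8K^2) give little in total, and every other one is at most N. A large sum therefore forces many
  large correlations.\<close>

lemma large_differences:
  fixes f :: "nat \<Rightarrow> complex" and K :: real
  assumes f: "\<And>y. norm (f y) = 1" and MN: "M \<le> N" and K: "2 \<le> K"
    and large: "real N \<le> K * norm (\<Sum>y<M. f y)" and N: "2 * K\<^sup>2 \<le> real N"
  defines "A \<equiv> {h \<in> {1..N}. h \<le> M \<and> real N \<le> 8 * K\<^sup>2 * norm (\<Sum>y<M - h. f (y + h) * cnj (f y))}"
  shows "real N \<le> 8 * K\<^sup>2 * real (card A)"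
proof -
  define D where "D h = (\<Sum>y<M - h. f (y + h) * cnj (f y))" for h
  have D: "norm (D h) \<le> real N" for h
  proof -
    have "norm (D h) \<le> (\<Sum>y<M - h. 1)"
      unfolding D_def by (intro sum_norm_le) (simp add: norm_mult f)
    thus ?thesis using MN by simp
  qed
  have K2: "0 < K\<^sup>2" using K by simp
  have finA: "finite A" by (simp add: A_def)
  have N0: "0 < real N" using N K2 by linarith
  have "(norm (\<Sum>y<M. f y))\<^sup>2 = real M + 2 * Re (\<Sum>h\<in>{1..M}. D h)"
    by (simp add: norm_sum_square_eq f D_def)
  also have "\<dots> \<le> real N + 2 * (\<Sum>h\<in>{1..M}. norm (D h))"
    using MN complex_Re_le_cmod[of "\<Sum>h\<in>{1..M}. D h"] norm_sum[of D "{1..M}"] by simp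
  also have "(\<Sum>h\<in>{1..M}. norm (D h)) \<le> (\<Sum>h\<in>{1..M}. (if h \<in> A then real N else 0) + real N / (8 * K\<^sup>2))"
  proof (intro sum_mono)
    fix h assume h: "h \<in> {1..M}"
    show "norm (D h) \<le> (if h \<in> A then real N else 0) + real N / (8 * K\<^sup>2)"
    proof (cases "h \<in> A")
      case True
      have "0 \<le> real N / (8 * K\<^sup>2)" by simp
      hence "norm (D h) \<le> real N + real N / (8 * K\<^sup>2)" using D[of h] by linarith
      thus ?thesis using True by simp
    next
      case False
      hence "8 * K\<^sup>2 * norm (D h) \<le> real N" using h MN by (auto simp: A_def D_def)
      thus ?thesis using False K2 by (simp add: field_simps)
    qed
  qed
  also have "(\<Sum>h\<in>{1..M}. (if h \<in> A then real N else 0) + real N / (8 * K\<^sup>2))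
      = real (card A) * real N + real M * (real N / (8 * K\<^sup>2))"
  proof -
    have "(\<Sum>h\<in>{1..M}. if h \<in> A then real N else 0) = (\<Sum>h\<in>{1..M} \<inter> A. real N)"
      by (rule sum.inter_restrict[symmetric]) simp
    moreover have "{1..M} \<inter> A = A" by (auto simp: A_def)
    ultimately show ?thesis by (simp add: sum.distrib)
  qed
  also have "real M * (real N / (8 * K\<^sup>2)) \<le> real N * (real N / (8 * K\<^sup>2))"
    using MN by (intro mult_right_mono) auto
  finally have "(norm (\<Sum>y<M. f y))\<^sup>2 \<le> real N + 2 * (real (card A) * real N + real N * (real N / (8 * K\<^sup>2)))"
    by simp
  hence "K\<^sup>2 * (norm (\<Sum>y<M. f y))\<^sup>2 \<le> K\<^sup>2 * (real N + 2 * (real (card A) * real N + real N * (real N / (8 * K\<^sup>2))))"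
    using K2 by (intro mult_left_mono) auto
  moreover have "(real N)\<^sup>2 \<le> K\<^sup>2 * (norm (\<Sum>y<M. f y))\<^sup>2"
    using power_mono[OF large, of 2] by (simp add: power_mult_distrib)
  moreover have "K\<^sup>2 * (real N + 2 * (real (card A) * real N + real N * (real N / (8 * K\<^sup>2))))
      = real N * (K\<^sup>2 + 2 * K\<^sup>2 * real (card A) + real N / 4)"
    using K by (simp add: field_simps power2_eq_square)
  ultimately have "real N * real N \<le> real N * (K\<^sup>2 + 2 * K\<^sup>2 * real (card A) + real N / 4)"
    by (simp add: power2_eq_square)
  hence "real N \<le> K\<^sup>2 + 2 * K\<^sup>2 * real (card A) + real N / 4"
    using N0 by (simp add: mult_le_cancel_left_pos)
  \<comment> \<open>Here \<open>K\<^sup>2\<close> is at most N/2, so N/4 remains to be covered by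
    the term with \<open>card A\<close>.\<close>
  thus ?thesis using N by simp
qed

text \<open>Pigeonhole: \<open>f\<close> has at most \<open>L\<close> values, so the most frequent
  one has at least the share 1/L. It serves to fix a single denominator for many shifts.\<close>

lemma popular_value:
  fixes A :: "'a set" and f :: "'a \<Rightarrow> nat" and L :: real
  assumes "finite A" "\<And>a. a \<in> A \<Longrightarrow> 1 \<le> f a \<and> real (f a) \<le> L" "A \<noteq> {}"
  obtains q where "q \<in> f ` A" "real (card A) \<le> L * real (card {a \<in> A. f a = q})"
proof -
  have fin: "finite (f ` A)" "f ` A \<noteq> {}" using assms by auto
  define c where "c = Max ((\<lambda>q. real (card {a \<in> A. f a = q})) ` f ` A)"
  have "c \<in> (\<lambda>q. real (card {a \<in> A. f a = q})) ` f ` A"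
    unfolding c_def using fin by (intro Max_in) auto
  then obtain q where q: "q \<in> f ` A" "c = real (card {a \<in> A. f a = q})" by blast
  have "real (card A) \<le> real (card (f ` A)) * c"
    by (rule card_le_card_image_times[OF assms(1)]) (use fin in \<open>auto simp: c_def intro!: Max_ge\<close>)
  also have "\<dots> \<le> L * c"
  proof (rule mult_right_mono)
    have "real (card (f ` A)) \<le> L - 1 + 1"
      using assms by (intro card_nat_interval_le) fastforce+
    thus "real (card (f ` A)) \<le> L" by simp
  qed (use q in simp)
  finally show ?thesis using that q by simp
qed

text \<open>All constants are absorbed into powers of \<open>K\<close>, which is why \<open>K \<ge> 2\<close> is assumed.\<close>

lemma exponential_sum_top_coeff:
  assumes "1 \<le> k"
  obtains C :: nat where
    "\<And>Q K N M. \<lbrakk>degree Q \<le> k; 2 \<le> K; 1 \<le> N; M \<le> N;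
        real N \<le> K * norm (\<Sum>y<M. ee (poly Q (real y)))\<rbrakk>
      \<Longrightarrow> \<exists>q::nat. \<exists>m::int. 1 \<le> q \<and> real q \<le> K ^ C \<and>
           \<bar>real q * coeff Q k - of_int m\<bar> \<le> K ^ C / real N ^ k"
  using assms
proof (induction k arbitrary: thesis rule: nat_induct_at_least)
  case base
  show ?case
  proof (rule base[of 1])
    fix Q :: "real poly" and K :: real and N M :: nat
    assume deg: "degree Q \<le> 1" and K: "2 \<le> K" and N: "1 \<le> N" and MN: "M \<le> N"
      and large: "real N \<le> K * norm (\<Sum>y<M. ee (poly Q (real y)))"
    define \<alpha> where "\<alpha> = coeff Q 1"
    have "poly Q x = coeff Q 0 + x * \<alpha>" for x
    proof -
      obtain a R where R: "Q = pCons a R" by (cases Q)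
      hence "degree R = 0" using deg by (cases "R = 0") auto
      then obtain b where "Q = [:a, b:]" using R degree_eq_zeroE by metis
      thus ?thesis by (simp add: \<alpha>_def)
    qed
    hence "(\<Sum>y<M. ee (poly Q (real y))) = ee (coeff Q 0) * (\<Sum>y<M. ee (real y * \<alpha>))"
      by (simp add: ee_add sum_distrib_left)
    hence "real N \<le> K * norm (\<Sum>y<M. ee (real y * \<alpha>))" using large by (simp add: norm_mult)
    hence "real N * \<bar>\<alpha> - of_int (round \<alpha>)\<bar>
        \<le> K * norm (\<Sum>y<M. ee (real y * \<alpha>)) * \<bar>\<alpha> - of_int (round \<alpha>)\<bar>"
      by (intro mult_right_mono) auto
    also have "\<dots> \<le> K * 1"
      unfolding mult.assoc using K by (intro mult_left_mono norm_sum_ee_le) auto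
    finally have "\<bar>real 1 * coeff Q 1 - of_int (round \<alpha>)\<bar> \<le> K ^ 1 / real N ^ 1"
      using N by (simp add: \<alpha>_def field_simps)
    thus "\<exists>q::nat. \<exists>m::int. 1 \<le> q \<and> real q \<le> K ^ 1 \<and>
        \<bar>real q * coeff Q 1 - of_int m\<bar> \<le> K ^ 1 / real N ^ 1"
      using K by (intro exI[of _ 1] exI[of _ "round \<alpha>"]) auto
  qed
next
  case (Suc k)
  obtain C where C: "\<And>Q K N M. \<lbrakk>degree Q \<le> k; 2 \<le> K; 1 \<le> N; M \<le> N;
        real N \<le> K * norm (\<Sum>y<M. ee (poly Q (real y)))\<rbrakk>
      \<Longrightarrow> \<exists>q::nat. \<exists>m::int. 1 \<le> q \<and> real q \<le> K ^ C \<and>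
           \<bar>real q * coeff Q k - of_int m\<bar> \<le> K ^ C / real N ^ k"
    using Suc.IH by blast
  \<comment> \<open>\<open>K ^ D\<close> is the size of \<open>N\<close> from which the recurrence
    lemma applies. \<open>E\<close> adds up the exponents needed by the small case, by the error
    term and by the denominator.\<close>
  define D where "D = 15 * C + 15"
  define E where "E = D * Suc k + 15 * C + 14 + 10 * C + 7 + k"
  show ?case
  proof (rule Suc.prems)
    fix Q :: "real poly" and K :: real and N M :: nat
    assume deg: "degree Q \<le> Suc k" and K: "2 \<le> K" and N: "1 \<le> N" and MN: "M \<le> N"
      and large: "real N \<le> K * norm (\<Sum>y<M. ee (poly Q (real y)))"
    define \<alpha> where "\<alpha> = coeff Q (Suc k)"
    have pw: "2 ^ n \<le> K ^ n" for n using K by (intro power_mono) auto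
    have mono: "K ^ a \<le> K ^ b" if "a \<le> b" for a b using K that by (intro power_increasing) auto
    have pos: "0 < K ^ n" for n using K by simp
    show "\<exists>q::nat. \<exists>m::int. 1 \<le> q \<and> real q \<le> K ^ E \<and>
           \<bar>real q * coeff Q (Suc k) - of_int m\<bar> \<le> K ^ E / real N ^ Suc k"
    proof (cases "real N \<le> K ^ D")
      case True
      \<comment> \<open>For small \<open>N\<close> the allowed error is at least 1, so denominator 1
        works.\<close>
      have "\<bar>\<alpha> - of_int (round \<alpha>)\<bar> \<le> 1"
        using of_int_round_abs_le[of \<alpha>] by (simp add: abs_minus_commute)
      also have "1 \<le> K ^ E / real N ^ Suc k"
      proof -
        have "real N ^ Suc k \<le> (K ^ D) ^ Suc k" using True by (intro power_mono) auto
        also have "\<dots> = K ^ (D * Suc k)" by (rule power_mult[symmetric])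
        also have "\<dots> \<le> K ^ E" by (rule mono) (simp add: E_def)
        finally show ?thesis using N by simp
      qed
      finally show ?thesis using K
        by (intro exI[of _ 1] exI[of _ "round \<alpha>"]) (auto simp: \<alpha>_def one_le_power)
    next
      case False
      hence ND: "K ^ D \<le> real N" by simp
      define f where "f y = ee (poly Q (real y))" for y
      define A where "A = {h \<in> {1..N}. h \<le> M \<and>
          real N \<le> 8 * K\<^sup>2 * norm (\<Sum>y<M - h. f (y + h) * cnj (f y))}"
      have "2 * K\<^sup>2 \<le> K ^ 1 * K\<^sup>2" using K by (intro mult_right_mono) auto
      also have "\<dots> = K ^ 3" by (simp add: power2_eq_square power3_eq_cube)
      also have "\<dots> \<le> K ^ D" by (rule mono) (simp add: D_def)
      finally have "2 * K\<^sup>2 \<le> real N" using ND by simp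
      hence A: "real N \<le> 8 * K\<^sup>2 * real (card A)"
        unfolding A_def using MN K large by (intro large_differences) (auto simp: f_def)
      have K5: "8 * K\<^sup>2 \<le> K ^ 5"
      proof -
        have "8 * K\<^sup>2 \<le> K ^ 3 * K\<^sup>2" using pw[of 3] by (intro mult_right_mono) auto
        thus ?thesis by (simp add: power_add[symmetric])
      qed
      have finA: "finite A" by (simp add: A_def)
      have "A \<noteq> {}" using A N by auto
      \<comment> \<open>The differenced sums are large with \<open>8 * K\<^sup>2\<close> in the role
        of \<open>K\<close>; the power \<open>K ^ 5\<close> absorbs the factor 8.\<close>
      define K' where "K' = K ^ 5"
      have K': "2 \<le> K'" using pw[of 5] by (simp add: K'_def)
      have "\<exists>q::nat. \<exists>m::int. 1 \<le> q \<and> real q \<le> K' ^ C \<and>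
         \<bar>real q * (real (Suc k) * real h * \<alpha>) - of_int m\<bar> \<le> K' ^ C / real N ^ k" if h: "h \<in> A" for h
      proof -
        define R where "R = pcompose Q [:real h, 1:] - Q"
        have R: "degree R \<le> k" "coeff R k = real (Suc k) * real h * \<alpha>"
          using difference_poly[OF deg, of "real h"] by (simp_all add: R_def \<alpha>_def)
        have "f (y + h) * cnj (f y) = ee (poly R (real y))" for y
          by (simp add: f_def R_def cnj_ee ee_add[symmetric] poly_pcompose add.commute)
        hence "real N \<le> 8 * K\<^sup>2 * norm (\<Sum>y<M - h. ee (poly R (real y)))"
          using h by (simp add: A_def)
        also have "\<dots> \<le> K' * norm (\<Sum>y<M - h. ee (poly R (real y)))"
          unfolding K'_def by (intro mult_right_mono K5) auto
        finally show ?thesis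
          using C[OF R(1) K' N, of "M - h"] MN R(2) by simp
      qed
      then obtain p m where pm: "\<And>h. h \<in> A \<Longrightarrow> 1 \<le> p h \<and> real (p h) \<le> K' ^ C \<and>
         \<bar>real (p h) * (real (Suc k) * real h * \<alpha>) - of_int (m h)\<bar> \<le> K' ^ C / real N ^ k"
        by metis
      obtain q where q: "q \<in> p ` A" "real (card A) \<le> K' ^ C * real (card {h \<in> A. p h = q})"
        using popular_value[OF finA, of p "K' ^ C"] pm \<open>A \<noteq> {}\<close> by blast
      \<comment> \<open>On \<open>A'\<close> the denominator is the same \<open>q\<close>, so
        \<open>h * \<beta>\<close> is within \<open>\<epsilon>\<close> of an integer for every
        \<open>h\<close> in \<open>A'\<close>, and \<open>A'\<close> has density at least 1/L in
        {1..N}: exactly the setting of the recurrence lemma.\<close>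
      define A' where "A' = {h \<in> A. p h = q}"
      define L where "L = K ^ (5 * C + 5)"
      define \<epsilon> where "\<epsilon> = K ^ (5 * C) / real N ^ k"
      define \<beta> where "\<beta> = real q * real (Suc k) * \<alpha>"
      have K'C: "K' ^ C = K ^ (5 * C)" by (simp add: K'_def power_mult)
      have L2: "L\<^sup>2 = K ^ (10 * C + 10)" by (simp add: L_def power_mult[symmetric] mult.commute)
      have N0: "0 < real N" using N by simp
      have Nk: "real N \<le> real N ^ k"
        using N \<open>1 \<le> k\<close> by (intro self_le_power) auto
      have LD: "32 * L\<^sup>2 * K ^ (5 * C) \<le> real N"
      proof -
        have "32 * L\<^sup>2 * K ^ (5 * C) \<le> K ^ 5 * L\<^sup>2 * K ^ (5 * C)"
          using pw[of 5] K by (intro mult_right_mono) auto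
        also have "\<dots> = K ^ D" by (simp add: L2 D_def power_add[symmetric])
        finally show ?thesis using ND by simp
      qed
      have "\<exists>q'::nat. \<exists>m::int. 1 \<le> q' \<and> real q' \<le> 2 * L \<and>
          \<bar>real q' * \<beta> - of_int m\<bar> \<le> 16 * L\<^sup>2 * \<epsilon> / real N"
      proof -
        have 1: "A' \<subseteq> {1..N}" by (auto simp: A'_def A_def)
        have 2: "2 \<le> L"
        proof -
          have "K ^ 1 \<le> L" unfolding L_def by (rule mono) simp
          thus ?thesis using K by simp
        qed
        have 3: "real N \<le> L * real (card A')"
        proof -
          have "real N \<le> K ^ 5 * real (card A)"
            using A mult_right_mono[OF K5, of "real (card A)"] by simp
          also have "\<dots> \<le> K ^ 5 * (K' ^ C * real (card A'))"
            using q(2) pos[of 5] by (intro mult_left_mono) (auto simp: A'_def)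
          also have "\<dots> = L * real (card A')" by (simp add: K'C L_def power_add)
          finally show ?thesis .
        qed
        have 4: "0 \<le> \<epsilon>" using K by (simp add: \<epsilon>_def)
        have 5: "32 * L\<^sup>2 * \<epsilon> \<le> 1"
          using order.trans[OF LD Nk] N0 by (simp add: \<epsilon>_def divide_le_eq)
        have 6: "16 * L\<^sup>2 \<le> real N"
        proof -
          have "16 * L\<^sup>2 * 1 \<le> 32 * L\<^sup>2 * K ^ (5 * C)"
            using K by (intro mult_mono) (auto intro: one_le_power)
          thus ?thesis using LD by simp
        qed
        have 7: "\<exists>m::int. \<bar>real h * \<beta> - of_int m\<bar> \<le> \<epsilon>" if "h \<in> A'" for h
          using pm[of h] that by (auto simp: A'_def \<beta>_def \<epsilon>_def K'C mult_ac)
        show ?thesis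
          using Vinogradov_recurrence[OF 1 2 3 4 5 6 7] by metis
      qed
      then obtain q' n where q': "1 \<le> q'" "real q' \<le> 2 * L"
          "\<bar>real q' * \<beta> - of_int n\<bar> \<le> 16 * L\<^sup>2 * \<epsilon> / real N" by blast
      have q1: "1 \<le> q" "real q \<le> K ^ (5 * C)" using q(1) pm by (auto simp: K'C)
      \<comment> \<open>The final denominator collects \<open>q'\<close> from the recurrence,
        \<open>q\<close> from the induction and \<open>Suc k\<close> from differentiating the top
        power.\<close>
      have "real (q' * q * Suc k) \<le> K ^ E"
      proof -
        have "real (Suc k) \<le> 2 ^ Suc k"
          by (metis less_exp less_imp_le of_nat_le_iff of_nat_numeral of_nat_power)
        hence "real (Suc k) \<le> K ^ Suc k" using pw[of "Suc k"] by simp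
        hence "real (q' * q * Suc k) \<le> (2 * L) * K ^ (5 * C) * K ^ Suc k"
          unfolding of_nat_mult using q' q1 pos by (intro mult_mono) (auto simp: L_def less_imp_le)
        also have "\<dots> \<le> (K ^ 1 * L) * K ^ (5 * C) * K ^ Suc k"
          using K pos by (intro mult_right_mono) (auto simp: L_def)
        also have "\<dots> = K ^ (10 * C + 7 + k)"
          unfolding L_def power_add[symmetric] by (rule arg_cong[where f = "power K"]) simp
        also have "\<dots> \<le> K ^ E" by (rule mono) (simp add: E_def)
        finally show ?thesis .
      qed
      moreover have "\<bar>real (q' * q * Suc k) * \<alpha> - of_int n\<bar> \<le> K ^ E / real N ^ Suc k"
      proof -
        have "\<bar>real (q' * q * Suc k) * \<alpha> - of_int n\<bar> \<le> 16 * L\<^sup>2 * \<epsilon> / real N"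
          using q'(3) unfolding \<beta>_def of_nat_mult by (simp only: mult_ac)
        also have "\<dots> \<le> K ^ 4 * L\<^sup>2 * \<epsilon> / real N"
          using pw[of 4] K by (intro divide_right_mono mult_right_mono) (auto simp: \<epsilon>_def)
        also have "\<dots> = K ^ (15 * C + 14) / real N ^ Suc k"
          by (simp add: L2 \<epsilon>_def power_add[symmetric] mult.commute)
        also have "\<dots> \<le> K ^ E / real N ^ Suc k"
          by (intro divide_right_mono mono) (auto simp: E_def)
        finally show ?thesis .
      qed
      moreover have "1 \<le> q' * q * Suc k" using q'(1) q1(1) by (simp add: Suc_le_eq)
      ultimately show ?thesis unfolding \<alpha>_def by blast
    qed
  qed
qed

section \<open>The linear coefficient\<close>

lemma norm_ee_diff_le: "norm (ee x - ee y) \<le> 8 * \<bar>x - y\<bar>"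
proof -
  have "ee x - ee y = - ee y * (1 - ee (x - y))"
    by (simp add: algebra_simps ee_add[symmetric])
  hence "norm (ee x - ee y) = 2 * \<bar>sin (pi * (x - y))\<bar>"
    by (simp add: norm_mult norm_one_minus_ee)
  also have "\<dots> \<le> 2 * \<bar>pi * (x - y)\<bar>" using abs_sin_x_le_abs_x by simp
  also have "\<dots> = (2 * pi) * \<bar>x - y\<bar>" by (simp add: abs_mult)
  also have "\<dots> \<le> 8 * \<bar>x - y\<bar>" using pi_less_4 by (intro mult_right_mono) auto
  finally show ?thesis .
qed

text \<open>Abel summation. The increments of \<open>b\<close> are dominated by those of
  \<open>t\<close>, which telescope, so only the end values of \<open>t\<close> enter.\<close>

lemma norm_sum_mult_le_partial_summation:
  fixes a b :: "nat \<Rightarrow> complex" and t :: "nat \<Rightarrow> real"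
  assumes a: "\<And>n. n \<le> M \<Longrightarrow> norm (\<Sum>y<n. a y) \<le> B"
    and b: "\<And>y. norm (b y) \<le> 1" "\<And>y. norm (b (Suc y) - b y) \<le> t (Suc y) - t y"
  shows "norm (\<Sum>y<M. a y * b y) \<le> B * (1 + t M - t 0)"
proof -
  have "(\<Sum>y<M. a y * b y)
      = (\<Sum>y<M. a y) * b M - (\<Sum>y<M. (\<Sum>z<Suc y. a z) * (b (Suc y) - b y))"
    by (induction M) (simp_all add: algebra_simps)
  also have "norm \<dots> \<le> norm ((\<Sum>y<M. a y) * b M) + norm (\<Sum>y<M. (\<Sum>z<Suc y. a z) * (b (Suc y) - b y))"
    by (rule norm_triangle_ineq4)
  also have "\<dots> \<le> B * 1 + (\<Sum>y<M. B * (t (Suc y) - t y))"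
  proof (intro add_mono sum_norm_le)
    have B: "0 \<le> B" using a[of 0] by simp
    show "norm ((\<Sum>y<M. a y) * b M) \<le> B * 1"
      unfolding norm_mult using a b B by (intro mult_mono) auto
    show "norm ((\<Sum>z<Suc y. a z) * (b (Suc y) - b y)) \<le> B * (t (Suc y) - t y)" if "y \<in> {..<M}" for y
      unfolding norm_mult using that b B by (intro mult_mono a) auto
  qed
  also have "(\<Sum>y<M. B * (t (Suc y) - t y)) = B * (t M - t 0)"
    by (simp add: sum_distrib_left[symmetric] sum_lessThan_telescope)
  finally show ?thesis by (simp add: algebra_simps)
qed

text \<open>Writing \<open>\<alpha> = m / q + \<theta>\<close>, partial summation removes the phase \<open>\<theta> * y ^ k\<close> and the
  Fourier expansion mod \<open>q\<close> turns \<open>m * y ^ k / q\<close> into linear phases \<open>j * y / q\<close>.\<close>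

lemma remove_top_term:
  fixes R :: "real poly" and \<alpha> K :: real
  assumes K: "2 \<le> K" and N: "1 \<le> N" and MN: "M \<le> N"
    and q: "1 \<le> q" "real q \<le> K ^ C" "\<bar>real q * \<alpha> - of_int m\<bar> \<le> K ^ C / real N ^ k"
    and large: "real N \<le> K * norm (\<Sum>y<M. ee (poly (R + monom \<alpha> k) (real y)))"
  obtains M' j :: nat where "M' \<le> N"
    "real N \<le> K ^ (2 * C + 5) * norm (\<Sum>y<M'. ee (poly (R + [:0, real j / real q:]) (real y)))"
proof (rule ccontr)
  define T where "T n j = (\<Sum>y<n. ee (poly (R + [:0, real j / real q:]) (real y)))" for n j :: nat
  note found = that
  assume "\<not> thesis"
  \<comment> \<open>If all sums with linear phases are small, the Fourier expansion costs a factor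
    \<open>K ^ C\<close> and partial summation a factor \<open>9 * K ^ C\<close>. This leaves at
    most 9 N / K^5, which is less than N / K because K^4 is at least 16.\<close>
  hence small: "K ^ (2 * C + 5) * norm (T n j) < real N" if "n \<le> N" for n j
    using found that unfolding T_def by (meson not_le)
  define \<theta> where "\<theta> = \<alpha> - of_int m / real q"
  define g where "g y = ee (of_int m * real y ^ k / real q)" for y
  define b where "b y = ee (\<theta> * real y ^ k)" for y
  define a where "a y = ee (poly R (real y)) * g y" for y
  have q0: "0 < real q" using q by simp
  have pos: "0 < K ^ n" for n using K by simp
  have "\<bar>\<theta>\<bar> \<le> real q * \<bar>\<theta>\<bar>" using q mult_right_mono[of 1 "real q" "\<bar>\<theta>\<bar>"] by simp
  also have "\<dots> = \<bar>real q * \<alpha> - of_int m\<bar>"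
  proof -
    have "real q * \<theta> = real q * \<alpha> - of_int m" using q0 by (simp add: \<theta>_def right_diff_distrib)
    thus ?thesis using q0 by (metis abs_mult abs_of_pos)
  qed
  finally have \<theta>: "\<bar>\<theta>\<bar> \<le> K ^ C / real N ^ k" using q by simp
  \<comment> \<open>Congruent arguments have congruent \<open>k\<close>-th powers, so the phases
    differ by an integer.\<close>
  have "g (y mod q) = g y" for y
  proof -
    define d where "d = y div q"
    have y: "int y = int (y mod q) + int d * int q"
      by (metis d_def of_nat_add of_nat_mult mod_mult_div_eq add.commute mult.commute)
    hence "int q dvd int y - int (y mod q)" by simp
    hence "int q dvd int y ^ k - int (y mod q) ^ k"
      by (metis dvd_trans dvd_triv_left power_diff_sumr2)
    then obtain e where "int y ^ k - int (y mod q) ^ k = int q * e" by (auto elim: dvdE)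
    hence "int y ^ k = int (y mod q) ^ k + int q * e" by simp
    hence "real_of_int (int y ^ k) = real_of_int (int (y mod q) ^ k + int q * e)" by simp
    hence "of_int m * real y ^ k / real q = of_int m * real (y mod q) ^ k / real q + of_int (m * e)"
      using q0 by (simp add: field_simps)
    thus ?thesis unfolding g_def by (metis ee_add_int)
  qed
  then obtain c where c: "\<And>j. norm (c j) \<le> 1" "\<And>y. g y = (\<Sum>j<q. c j * ee (real j * real y / real q))"
    using finite_Fourier_expansion[of q g] q by (auto simp: g_def)
  have aT: "norm (\<Sum>y<n. a y) \<le> real N / K ^ (C + 5)" if "n \<le> M" for n
  proof -
    have "a y = (\<Sum>j<q. c j * ee (poly (R + [:0, real j / real q:]) (real y)))" for y
      by (simp add: a_def c(2) sum_distrib_left ee_add mult_ac)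
    hence "(\<Sum>y<n. a y) = (\<Sum>j<q. c j * T n j)"
      unfolding T_def sum_distrib_left by (simp add: sum.swap[of _ "{..<q}"])
    also have "norm \<dots> \<le> (\<Sum>j<q. real N / K ^ (2 * C + 5))"
    proof (rule sum_norm_le)
      fix j
      have "norm (c j * T n j) \<le> 1 * norm (T n j)"
        unfolding norm_mult by (intro mult_right_mono c) auto
      also have "\<dots> \<le> real N / K ^ (2 * C + 5)"
        using small[of n j] that MN pos[of "2 * C + 5"] by (simp add: field_simps)
      finally show "norm (c j * T n j) \<le> real N / K ^ (2 * C + 5)" .
    qed
    also have "\<dots> = real q * (real N / K ^ (2 * C + 5))" by simp
    also have "\<dots> \<le> K ^ C * (real N / K ^ (2 * C + 5))"
      using K by (intro mult_right_mono q) auto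
    also have "\<dots> = real N / K ^ (C + 5)"
    proof -
      have "K ^ (2 * C + 5) = K ^ C * K ^ (C + 5)" by (simp only: power_add[symmetric]) simp
      thus ?thesis using K by simp
    qed
    finally show ?thesis .
  qed
  \<comment> \<open>The dominating function is \<open>8 * \<bar>\<theta>\<bar> * y ^ k\<close>,
    increments of which bound those of \<open>b\<close> by the Lipschitz estimate for
    \<open>ee\<close>; at \<open>M\<close> it is at most \<open>8 * K ^ C\<close>.\<close>
  have "norm (\<Sum>y<M. a y * b y) \<le> real N / K ^ (C + 5) * (1 + 8 * \<bar>\<theta>\<bar> * real M ^ k - 8 * \<bar>\<theta>\<bar> * real 0 ^ k)"
  proof (rule norm_sum_mult_le_partial_summation[OF aT])
    show "norm (b (Suc y) - b y) \<le> 8 * \<bar>\<theta>\<bar> * real (Suc y) ^ k - 8 * \<bar>\<theta>\<bar> * real y ^ k" for y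
    proof -
      have "real y ^ k \<le> real (Suc y) ^ k" by (intro power_mono) auto
      hence "\<bar>\<theta> * real (Suc y) ^ k - \<theta> * real y ^ k\<bar> = \<bar>\<theta>\<bar> * (real (Suc y) ^ k - real y ^ k)"
        by (simp add: right_diff_distrib[symmetric] abs_mult)
      thus ?thesis using norm_ee_diff_le[of "\<theta> * real (Suc y) ^ k" "\<theta> * real y ^ k"]
        by (simp add: b_def right_diff_distrib)
    qed
  qed (simp_all add: b_def)
  also have "\<dots> \<le> real N / K ^ (C + 5) * (9 * K ^ C)"
  proof (rule mult_left_mono)
    have "8 * (\<bar>\<theta>\<bar> * real M ^ k) \<le> 8 * (K ^ C / real N ^ k * real N ^ k)"
      using \<theta> MN K by (intro mult_left_mono mult_mono power_mono) auto
    hence "8 * \<bar>\<theta>\<bar> * real M ^ k \<le> 8 * K ^ C" using N by simp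
    moreover have "0 \<le> 8 * \<bar>\<theta>\<bar> * real 0 ^ k" by simp
    moreover have "1 \<le> K ^ C" using K by simp
    ultimately show "1 + 8 * \<bar>\<theta>\<bar> * real M ^ k - 8 * \<bar>\<theta>\<bar> * real 0 ^ k \<le> 9 * K ^ C" by linarith
  qed (use K in simp)
  also have "\<dots> = real N * 9 / K ^ 5" using K by (simp add: power_add)
  finally have "K * norm (\<Sum>y<M. a y * b y) \<le> K * (real N * 9 / K ^ 5)"
    using K by (intro mult_left_mono) auto
  moreover have "a y * b y = ee (poly (R + monom \<alpha> k) (real y))" for y
    using q0 by (simp add: a_def b_def g_def \<theta>_def ee_add[symmetric] poly_monom algebra_simps)
  ultimately have "real N \<le> K * (real N * 9 / K ^ 5)" using large by simp
  also have "\<dots> = real N * (9 / K ^ 4)" using K by (simp add: power_numeral_reduce)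
  finally have "real N * 1 \<le> real N * (9 / K ^ 4)" by simp
  hence "1 \<le> 9 / K ^ 4" using N by (subst (asm) mult_le_cancel_left_pos) auto
  moreover have "2 ^ 4 \<le> K ^ 4" using K by (intro power_mono) auto
  ultimately show False using pos[of 4] by (simp add: field_simps)
qed

text \<open>Induction on the degree: the top coefficient is well approximable, hence can be traded
  for a linear phase j/q. This shifts the linear coefficient by j/q, and multiplying the denominator
  by \<open>q\<close> undoes the shift.\<close>

lemma exponential_sum_linear_coeff:
  assumes "1 \<le> k"
  obtains C :: nat where
    "\<And>Q K N M. \<lbrakk>degree Q \<le> k; 2 \<le> K; 1 \<le> N; M \<le> N;
        real N \<le> K * norm (\<Sum>y<M. ee (poly Q (real y)))\<rbrakk>
      \<Longrightarrow> \<exists>q::nat. \<exists>m::int. 1 \<le> q \<and> real q \<le> K ^ C \<and>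
           \<bar>real q * coeff Q 1 - of_int m\<bar> \<le> K ^ C / real N"
  using assms
proof (induction k arbitrary: thesis rule: nat_induct_at_least)
  case base
  show ?case
    using exponential_sum_top_coeff[of 1, simplified] base by (metis One_nat_def)
next
  case (Suc k)
  obtain C\<^sub>1 where C\<^sub>1: "\<And>Q K N M. \<lbrakk>degree Q \<le> k; 2 \<le> K; 1 \<le> N; M \<le> N;
        real N \<le> K * norm (\<Sum>y<M. ee (poly Q (real y)))\<rbrakk>
      \<Longrightarrow> \<exists>q::nat. \<exists>m::int. 1 \<le> q \<and> real q \<le> K ^ C\<^sub>1 \<and>
           \<bar>real q * coeff Q 1 - of_int m\<bar> \<le> K ^ C\<^sub>1 / real N"
    using Suc.IH by blast
  obtain C where C: "\<And>Q K N M. \<lbrakk>degree Q \<le> Suc k; 2 \<le> K; 1 \<le> N; M \<le> N;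
        real N \<le> K * norm (\<Sum>y<M. ee (poly Q (real y)))\<rbrakk>
      \<Longrightarrow> \<exists>q::nat. \<exists>m::int. 1 \<le> q \<and> real q \<le> K ^ C \<and>
           \<bar>real q * coeff Q (Suc k) - of_int m\<bar> \<le> K ^ C / real N ^ Suc k"
    using exponential_sum_top_coeff[of "Suc k"] by auto
  define E where "E = C + (2 * C + 5) * C\<^sub>1"
  show ?case
  proof (rule Suc.prems)
    fix Q :: "real poly" and K :: real and N M :: nat
    assume deg: "degree Q \<le> Suc k" and K: "2 \<le> K" and N: "1 \<le> N" and MN: "M \<le> N"
      and large: "real N \<le> K * norm (\<Sum>y<M. ee (poly Q (real y)))"
    obtain q m where q: "1 \<le> q" "real q \<le> K ^ C"
        "\<bar>real q * coeff Q (Suc k) - of_int m\<bar> \<le> K ^ C / real N ^ Suc k"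
      using C[OF deg K N MN large] by blast
    define R where "R = Q - monom (coeff Q (Suc k)) (Suc k)"
    have degR: "degree R \<le> k"
    proof (rule degree_le, intro allI impI)
      fix i assume "k < i"
      thus "coeff R i = 0" using deg by (cases "i = Suc k") (auto simp: R_def coeff_eq_0)
    qed
    have R1: "coeff R 1 = coeff Q 1" using \<open>1 \<le> k\<close> by (simp add: R_def)
    have "real N \<le> K * norm (\<Sum>y<M. ee (poly (R + monom (coeff Q (Suc k)) (Suc k)) (real y)))"
      using large by (simp add: R_def)
    then obtain M' j where j: "M' \<le> N"
        "real N \<le> K ^ (2 * C + 5) * norm (\<Sum>y<M'. ee (poly (R + [:0, real j / real q:]) (real y)))"
      using remove_top_term[OF K N MN q] by blast
    have "2 ^ 1 \<le> K ^ 1" using K by simp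
    also have "\<dots> \<le> K ^ (2 * C + 5)" using K by (intro power_increasing) auto
    finally have K': "2 \<le> K ^ (2 * C + 5)" by simp
    have "degree (R + [:0, real j / real q:]) \<le> k"
      using degR \<open>1 \<le> k\<close> by (intro degree_add_le) auto
    from C\<^sub>1[OF this K' N j] obtain p n where p: "1 \<le> p" "real p \<le> (K ^ (2 * C + 5)) ^ C\<^sub>1"
        "\<bar>real p * (coeff Q 1 + real j / real q) - of_int n\<bar> \<le> (K ^ (2 * C + 5)) ^ C\<^sub>1 / real N"
      by (auto simp: R1 simp del: One_nat_def) (auto simp: R1)
    have E: "K ^ C * (K ^ (2 * C + 5)) ^ C\<^sub>1 = K ^ E"
      by (simp only: E_def power_add power_mult)
    have "real (q * p) \<le> K ^ E"
      unfolding of_nat_mult E[symmetric] using q p K by (intro mult_mono) auto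
    moreover have "\<bar>real (q * p) * coeff Q 1 - of_int (int q * n - int (p * j))\<bar> \<le> K ^ E / real N"
    proof -
      have "real (q * p) * coeff Q 1 - of_int (int q * n - int (p * j))
          = real q * (real p * (coeff Q 1 + real j / real q) - of_int n)"
        using q by (simp add: field_simps)
      hence "\<bar>real (q * p) * coeff Q 1 - of_int (int q * n - int (p * j))\<bar>
          = real q * \<bar>real p * (coeff Q 1 + real j / real q) - of_int n\<bar>"
        by (simp add: abs_mult)
      also have "\<dots> \<le> K ^ C * ((K ^ (2 * C + 5)) ^ C\<^sub>1 / real N)"
        using q p K by (intro mult_mono) auto
      finally show ?thesis by (simp add: E[symmetric])
    qed
    ultimately show "\<exists>q::nat. \<exists>m::int. 1 \<le> q \<and> real q \<le> K ^ E \<and>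
           \<bar>real q * coeff Q 1 - of_int m\<bar> \<le> K ^ E / real N"
      using q p by (intro exI[of _ "q * p"] exI[of _ "int q * n - int (p * j)"]) auto
  qed
qed

section \<open>Discrepancy\<close>

text \<open>This is \<open>H\<close> times the classical Fejer kernel. As a square it is visibly
  nonnegative, and its tail is controlled by the geometric sum bound.\<close>

definition Fejer :: "nat \<Rightarrow> real \<Rightarrow> real" where
  "Fejer H s = (norm (\<Sum>h<H. ee (real h * s)))\<^sup>2"

lemma Fejer_nonneg: "0 \<le> Fejer H s"
  by (simp add: Fejer_def)

lemma Fejer_eq: "Fejer H s = real H + 2 * Re (\<Sum>l\<in>{1..H}. of_nat (H - l) * ee (real l * s))"
proof -
  have "ee (real (y + l) * s) * cnj (ee (real y * s)) = ee (real l * s)" for y l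
    by (simp add: cnj_ee ee_add[symmetric] algebra_simps)
  thus ?thesis by (simp add: Fejer_def norm_sum_square_eq)
qed

text \<open>Averaging over the shifts i/H kills every frequency not divisible by \<open>H\<close>;
  frequency \<open>H\<close> itself has weight 0, and only the constant term \<open>H\<close> of
  each kernel survives.\<close>

lemma sum_Fejer_shifts:
  assumes "0 < H"
  shows "(\<Sum>i<H. Fejer H (x - real i / real H)) = (real H)\<^sup>2"
proof -
  have zero: "of_nat (H - l) * (\<Sum>i<H. ee (real i * of_int (- int l) / real H)) = 0" if "l \<in> {1..H}" for l
  proof (cases "l = H")
    case False
    hence "\<not> int H dvd - int l" using that by (auto dest: dvd_imp_le)
    thus ?thesis by (simp only: sum_ee_orthogonal[OF assms] if_False mult_zero_right)
  qed simp
  have "ee (real l * (x - real i / real H)) = ee (real l * x) * ee (real i * of_int (- int l) / real H)"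
    for l i by (simp add: ee_add[symmetric] right_diff_distrib mult.commute)
  hence "(\<Sum>i<H. \<Sum>l\<in>{1..H}. of_nat (H - l) * ee (real l * (x - real i / real H)))
      = (\<Sum>l\<in>{1..H}. \<Sum>i<H. ee (real l * x) * (of_nat (H - l) * ee (real i * of_int (- int l) / real H)))"
    by (subst sum.swap) (simp only: mult_ac)
  also have "\<dots> = (\<Sum>l\<in>{1..H}. ee (real l * x) * (of_nat (H - l) * (\<Sum>i<H. ee (real i * of_int (- int l) / real H))))"
    by (simp only: sum_distrib_left)
  also have "\<dots> = 0" by (intro sum.neutral ballI) (simp only: zero mult_zero_right)
  finally have "(\<Sum>i<H. \<Sum>l\<in>{1..H}. of_nat (H - l) * ee (real l * (x - real i / real H))) = 0" .
  moreover have "(\<Sum>i<H. Fejer H (x - real i / real H)) = (real H)\<^sup>2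
      + 2 * Re (\<Sum>i<H. \<Sum>l\<in>{1..H}. of_nat (H - l) * ee (real l * (x - real i / real H)))"
    by (simp add: Fejer_eq sum.distrib sum_distrib_left power2_eq_square)
  ultimately show ?thesis by simp
qed

text \<open>The constant term of the kernel gives the main term; the triangular weights
  \<open>H - l\<close> of the other frequencies add up to at most half of
  \<open>H\<^sup>2\<close>.\<close>

lemma sum_Fejer_le:
  fixes x :: "nat \<Rightarrow> real"
  assumes E: "\<And>l. \<lbrakk>1 \<le> l; l < H\<rbrakk> \<Longrightarrow> norm (\<Sum>y<N. ee (real l * x y)) \<le> E" and "0 \<le> E"
  shows "(\<Sum>y<N. Fejer H (x y - s)) \<le> real H * real N + (real H)\<^sup>2 * E"
proof -
  have "(\<Sum>y<N. \<Sum>l\<in>{1..H}. of_nat (H - l) * ee (real l * (x y - s)))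
      = (\<Sum>l\<in>{1..H}. of_nat (H - l) * (ee (- (real l * s)) * (\<Sum>y<N. ee (real l * x y))))"
    by (subst sum.swap) (simp add: sum_distrib_left right_diff_distrib ee_add[symmetric])
  also have "norm \<dots> \<le> (\<Sum>l\<in>{1..H}. real (H - l) * E)"
  proof (rule sum_norm_le)
    fix l assume l: "l \<in> {1..H}"
    show "norm (of_nat (H - l) * (ee (- (real l * s)) * (\<Sum>y<N. ee (real l * x y)))) \<le> real (H - l) * E"
      unfolding norm_mult norm_ee norm_of_nat mult_1_left
      using E[of l] l by (cases "l = H") (auto intro!: mult_left_mono)
  qed
  also have "\<dots> = (\<Sum>l<H. real l) * E"
  proof -
    have "(\<Sum>l\<in>{1..H}. real (H - l)) = (\<Sum>l<H. real l)"
      by (rule sum.reindex_bij_witness[of _ "\<lambda>l. H - l" "\<lambda>l. H - l"]) auto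
    thus ?thesis by (simp only: sum_distrib_right[symmetric])
  qed
  also have "\<dots> \<le> (real H)\<^sup>2 / 2 * E"
  proof (rule mult_right_mono[OF _ \<open>0 \<le> E\<close>])
    show "(\<Sum>l<H. real l) \<le> (real H)\<^sup>2 / 2"
      by (induction H) (auto simp: power2_eq_square algebra_simps)
  qed
  finally have "norm (\<Sum>y<N. \<Sum>l\<in>{1..H}. of_nat (H - l) * ee (real l * (x y - s))) \<le> (real H)\<^sup>2 / 2 * E" .
  hence "Re (\<Sum>y<N. \<Sum>l\<in>{1..H}. of_nat (H - l) * ee (real l * (x y - s))) \<le> (real H)\<^sup>2 / 2 * E"
    using complex_Re_le_cmod order.trans by blast
  moreover have "(\<Sum>y<N. Fejer H (x y - s)) = real H * real N
      + 2 * Re (\<Sum>y<N. \<Sum>l\<in>{1..H}. of_nat (H - l) * ee (real l * (x y - s)))"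
    by (simp add: Fejer_eq sum.distrib sum_distrib_left)
  ultimately show ?thesis by simp
qed

lemma Fejer_tail:
  assumes "0 < \<eta>" "\<And>m::int. \<eta> \<le> \<bar>s - of_int m\<bar>"
  shows "Fejer H s \<le> 1 / \<eta>\<^sup>2"
proof -
  define S where "S = norm (\<Sum>h<H. ee (real h * s))"
  have "S * \<eta> \<le> S * \<bar>s - of_int (round s)\<bar>"
    using assms(2) by (intro mult_left_mono) (auto simp: S_def)
  also have "\<dots> \<le> 1" unfolding S_def by (rule norm_sum_ee_le)
  finally have "(S * \<eta>)\<^sup>2 \<le> 1\<^sup>2" using assms(1) by (intro power_mono) (auto simp: S_def)
  hence "S\<^sup>2 \<le> 1 / \<eta>\<^sup>2" using assms(1) by (simp add: power_mult_distrib field_simps)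
  thus ?thesis by (simp add: Fejer_def S_def)
qed

text \<open>The shifted kernels \<open>Fejer H (x - i / H) / H\<^sup>2\<close> form a partition of unity, and only the shifts
  in \<open>B\<close> contribute substantially on \<open>A\<close>.\<close>

lemma card_le_by_Fejer:
  fixes x :: "nat \<Rightarrow> real"
  assumes H: "0 < H" and E: "\<And>l. \<lbrakk>1 \<le> l; l < H\<rbrakk> \<Longrightarrow> norm (\<Sum>y<N. ee (real l * x y)) \<le> E" "0 \<le> E"
    and A: "A \<subseteq> {..<N}" and B: "B \<subseteq> {..<H}" and \<eta>: "0 < \<eta>"
    and far: "\<And>y i m. \<lbrakk>y \<in> A; i < H; i \<notin> B\<rbrakk> \<Longrightarrow> \<eta> \<le> \<bar>x y - real i / real H - of_int (m::int)\<bar>"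
  shows "real (card A) \<le> real (card B) * (real N / real H + E) + real N / (\<eta>\<^sup>2 * real H)"
proof -
  have fin: "finite A" "finite B" using A B finite_subset by blast+
  have "real (card A) * (real H)\<^sup>2 = (\<Sum>y\<in>A. \<Sum>i<H. Fejer H (x y - real i / real H))"
    using H by (simp add: sum_Fejer_shifts)
  also have "\<dots> \<le> (\<Sum>y\<in>A. (\<Sum>i\<in>B. Fejer H (x y - real i / real H)) + real H / \<eta>\<^sup>2)"
  proof (rule sum_mono)
    fix y assume y: "y \<in> A"
    have "(\<Sum>i<H. Fejer H (x y - real i / real H))
        = (\<Sum>i\<in>{..<H} - B. Fejer H (x y - real i / real H)) + (\<Sum>i\<in>B. Fejer H (x y - real i / real H))"
      using B by (intro sum.subset_diff) auto
    also have "(\<Sum>i\<in>{..<H} - B. Fejer H (x y - real i / real H)) \<le> (\<Sum>i\<in>{..<H} - B. 1 / \<eta>\<^sup>2)"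
      using y by (intro sum_mono Fejer_tail \<eta> far) auto
    also have "\<dots> \<le> real H * (1 / \<eta>\<^sup>2)"
      using card_mono[of "{..<H}" "{..<H} - B"] unfolding sum_constant
      by (intro mult_right_mono) auto
    finally show "(\<Sum>i<H. Fejer H (x y - real i / real H))
        \<le> (\<Sum>i\<in>B. Fejer H (x y - real i / real H)) + real H / \<eta>\<^sup>2" by simp
  qed
  also have "\<dots> = (\<Sum>i\<in>B. \<Sum>y\<in>A. Fejer H (x y - real i / real H)) + real (card A) * (real H / \<eta>\<^sup>2)"
    by (simp add: sum.distrib sum.swap[of _ B A])
  \<comment> \<open>Positivity of the kernel allows extending the sum from \<open>A\<close> to all
    \<open>y < N\<close>, where the exponential sum bounds apply.\<close>
  also have "\<dots> \<le> (\<Sum>i\<in>B. real H * real N + (real H)\<^sup>2 * E) + real N * (real H / \<eta>\<^sup>2)"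
  proof (intro add_mono sum_mono mult_right_mono)
    fix i
    have "(\<Sum>y\<in>A. Fejer H (x y - real i / real H)) \<le> (\<Sum>y<N. Fejer H (x y - real i / real H))"
      using A by (intro sum_mono2) (auto simp: Fejer_nonneg)
    also have "\<dots> \<le> real H * real N + (real H)\<^sup>2 * E" using E by (rule sum_Fejer_le)
    finally show "(\<Sum>y\<in>A. Fejer H (x y - real i / real H)) \<le> real H * real N + (real H)\<^sup>2 * E" .
  next
    show "real (card A) \<le> real N" using card_mono[OF _ A] by simp
  qed simp
  also have "\<dots> = (real (card B) * (real N / real H + E) + real N / (\<eta>\<^sup>2 * real H)) * (real H)\<^sup>2"
    using H \<eta> by (simp add: field_simps power2_eq_square)
  finally show ?thesis using H by (simp add: mult_le_cancel_right)
qed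

text \<open>The choice \<open>H = G\<^sup>3\<close>, \<open>\<eta> = 1 / G\<close>, \<open>E = N / G\<^sup>4\<close> makes every error term \<open>O(N / G)\<close>.\<close>

lemma frac_count_le:
  fixes x :: "nat \<Rightarrow> real" and G N :: nat
  assumes G: "2 \<le> G" and \<rho>: "0 \<le> \<rho>" "\<rho> \<le> 1"
    and E: "\<And>l. \<lbrakk>1 \<le> l; l < G ^ 3\<rbrakk> \<Longrightarrow> norm (\<Sum>y<N. ee (real l * x y)) \<le> real N / real G ^ 4"
    and AB: "A \<subseteq> {..<N}" "B \<subseteq> {..<G ^ 3}" "real (card B) \<le> (\<rho> + 2 / real G) * real (G ^ 3) + 2"
    and far: "\<And>y i m. \<lbrakk>y \<in> A; i < G ^ 3; i \<notin> B\<rbrakk>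
      \<Longrightarrow> 1 / real G \<le> \<bar>x y - real i / real (G ^ 3) - of_int (m::int)\<bar>"
  shows "real (card A) \<le> \<rho> * real N + 10 * (real N / real G)"
proof -
  define g where "g = real G"
  have g: "2 \<le> g" using G by (simp add: g_def)
  have "real (card A) \<le> real (card B) * (real N / real (G ^ 3) + real N / real G ^ 4)
      + real N / ((1 / real G)\<^sup>2 * real (G ^ 3))"
    using G E AB far by (intro card_le_by_Fejer) auto
  also have "\<dots> = real (card B) * (real N / g ^ 3 + real N / g ^ 4) + real N / g"
    using g by (simp add: g_def[symmetric] field_simps power2_eq_square power3_eq_cube)
  also have "\<dots> \<le> ((\<rho> + 2 / g) * g ^ 3 + 2) * (real N / g ^ 3 + real N / g ^ 4) + real N / g"
    using AB(3) g by (intro add_right_mono mult_right_mono) (auto simp: g_def)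
  also have "\<dots> = \<rho> * real N + (real N / g) * (3 + \<rho> + 2 / g + 2 / g ^ 2 + 2 / g ^ 3)"
    using g by (simp add: field_simps power2_eq_square power3_eq_cube power4_eq_xxxx)
  also have "\<dots> \<le> \<rho> * real N + (real N / g) * 10"
  proof (intro add_left_mono mult_left_mono)
    have "2 / g ^ i \<le> 2" for i using g by (simp add: divide_le_eq)
    from this[of 1] this[of 2] this[of 3]
    show "3 + \<rho> + 2 / g + 2 / g ^ 2 + 2 / g ^ 3 \<le> 10" using \<rho> by simp
  qed (use g in auto)
  finally show ?thesis unfolding g_def by (simp only: mult.commute)
qed

text \<open>Only upper bounds are available, but applying them to the set and to its complement
  gives both directions, since the two counts add up to \<open>N\<close>.\<close>

lemma frac_count_discrepancy:
  fixes x :: "nat \<Rightarrow> real" and G N :: nat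
  assumes G: "2 \<le> G" and \<rho>: "0 \<le> \<rho>" "\<rho> \<le> 1"
    and E: "\<And>l. \<lbrakk>1 \<le> l; l < G ^ 3\<rbrakk> \<Longrightarrow> norm (\<Sum>y<N. ee (real l * x y)) \<le> real N / real G ^ 4"
  shows "\<bar>real (card {y. y < N \<and> frac (x y) < \<rho>}) - \<rho> * real N\<bar> \<le> 10 * (real N / real G)"
proof -
  define \<eta> where "\<eta> = 1 / real G"
  define H where "H = G ^ 3"
  have H: "0 < real H" using G by (simp add: H_def)
  have two: "2 / real G = 2 * \<eta>" by (simp add: \<eta>_def)
  have \<eta>: "0 < \<eta>" "\<eta> \<le> 1" using G by (auto simp: \<eta>_def)
  \<comment> \<open>A shift is far from \<open>z\<close> on the circle if it differs from
    \<open>frac z\<close> by more than \<open>\<eta>\<close> and, to exclude wrap-around, by less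
    than \<open>1 - \<eta>\<close>.\<close>
  have far: "\<eta> \<le> \<bar>z - i - of_int m\<bar>" if "i - frac z > \<eta> \<and> i - frac z < 1 - \<eta> \<or> frac z - i > \<eta> \<and> frac z - i < 1 - \<eta>"
    for z i :: real and m :: int
  proof -
    define k where "k = m - \<lfloor>z\<rfloor>"
    have eq: "z - i - of_int m = frac z - i - of_int k" by (simp add: k_def frac_def)
    consider "k \<le> -1" | "k = 0" | "k \<ge> 1" by linarith
    thus ?thesis
    proof cases
      case 1
      hence "real_of_int k \<le> -1" by linarith
      thus ?thesis unfolding eq using that \<eta> by linarith
    next
      case 3
      hence "1 \<le> real_of_int k" by linarith
      thus ?thesis unfolding eq using that \<eta> by linarith
    qed (use that in \<open>auto simp: eq\<close>)
  qed
  have scale: "i \<le> c * real H \<longleftrightarrow> i / real H \<le> c" "c * real H \<le> i \<longleftrightarrow> c \<le> i / real H" for i c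
    using H by (simp_all add: field_simps)
  have upper: "real (card {y. y < N \<and> frac (x y) < \<rho>}) \<le> \<rho> * real N + 10 * (real N / real G)"
  proof (rule frac_count_le[OF G \<rho> E])
    \<comment> \<open>The shifts within \<open>\<eta>\<close> of [0, \<open>\<rho>\<close>] on the
      circle; the second set lies across the point 1 = 0.\<close>
    define B where "B = {i. i < H \<and> real i / real H \<le> \<rho> + \<eta>} \<union> {i. i < H \<and> 1 - \<eta> \<le> real i / real H}"
    show "B \<subseteq> {..<G ^ 3}" by (auto simp: B_def H_def)
    have "real (card {i. i < H \<and> real i / real H \<le> \<rho> + \<eta>}) \<le> (\<rho> + \<eta>) * real H - 0 + 1"
      using \<rho> \<eta> by (intro card_nat_interval_le) (auto simp: scale add_nonneg_nonneg)
    moreover have "real (card {i. i < H \<and> 1 - \<eta> \<le> real i / real H}) \<le> real H - (1 - \<eta>) * real H + 1"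
    proof (intro card_nat_interval_le)
      have "(1 - \<eta>) * real H \<le> 1 * real H" using \<eta> by (intro mult_right_mono) auto
      thus "(1 - \<eta>) * real H \<le> real H + 1" by simp
    qed (auto simp: scale)
    moreover have "real (card B) \<le> real (card {i. i < H \<and> real i / real H \<le> \<rho> + \<eta>})
        + real (card {i. i < H \<and> 1 - \<eta> \<le> real i / real H})"
      unfolding B_def of_nat_add[symmetric] of_nat_le_iff by (rule card_Un_le)
    ultimately show "real (card B) \<le> (\<rho> + 2 / real G) * real (G ^ 3) + 2"
      unfolding H_def[symmetric] two by (simp add: algebra_simps)
    show "1 / real G \<le> \<bar>x y - real i / real (G ^ 3) - of_int m\<bar>"
      if "y \<in> {y. y < N \<and> frac (x y) < \<rho>}" "i < G ^ 3" "i \<notin> B" for y i and m :: int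
      unfolding H_def[symmetric] \<eta>_def[symmetric]
    proof (rule far)
      have "0 \<le> frac (x y)" "frac (x y) < \<rho>" using that by auto
      moreover have "\<rho> + \<eta> < real i / real H" "real i / real H < 1 - \<eta>"
        using that by (auto simp: B_def H_def[symmetric])
      ultimately show "real i / real H - frac (x y) > \<eta> \<and> real i / real H - frac (x y) < 1 - \<eta> \<or>
          frac (x y) - real i / real H > \<eta> \<and> frac (x y) - real i / real H < 1 - \<eta>" by linarith
    qed
  qed auto
  have lower: "real (card {y. y < N \<and> \<rho> \<le> frac (x y)}) \<le> (1 - \<rho>) * real N + 10 * (real N / real G)"
  proof (rule frac_count_le[OF G _ _ E])
    \<comment> \<open>Likewise for the complementary arc [\<open>\<rho>\<close>, 1); now the first
      set is the part that wraps around.\<close>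
    define B where "B = {i. i < H \<and> real i / real H \<le> \<eta>} \<union> {i. i < H \<and> \<rho> - \<eta> \<le> real i / real H}"
    show "B \<subseteq> {..<G ^ 3}" by (auto simp: B_def H_def)
    have "real (card {i. i < H \<and> real i / real H \<le> \<eta>}) \<le> \<eta> * real H - 0 + 1"
      using \<eta> by (intro card_nat_interval_le) (auto simp: scale add_nonneg_nonneg)
    moreover have "real (card {i. i < H \<and> \<rho> - \<eta> \<le> real i / real H}) \<le> real H - (\<rho> - \<eta>) * real H + 1"
    proof (intro card_nat_interval_le)
      have "(\<rho> - \<eta>) * real H \<le> 1 * real H" using \<eta> \<rho> by (intro mult_right_mono) auto
      thus "(\<rho> - \<eta>) * real H \<le> real H + 1" by simp
    qed (auto simp: scale)
    moreover have "real (card B) \<le> real (card {i. i < H \<and> real i / real H \<le> \<eta>})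
        + real (card {i. i < H \<and> \<rho> - \<eta> \<le> real i / real H})"
      unfolding B_def of_nat_add[symmetric] of_nat_le_iff by (rule card_Un_le)
    ultimately show "real (card B) \<le> ((1 - \<rho>) + 2 / real G) * real (G ^ 3) + 2"
      unfolding H_def[symmetric] two by (simp add: algebra_simps)
    show "1 / real G \<le> \<bar>x y - real i / real (G ^ 3) - of_int m\<bar>"
      if "y \<in> {y. y < N \<and> \<rho> \<le> frac (x y)}" "i < G ^ 3" "i \<notin> B" for y i and m :: int
      unfolding H_def[symmetric] \<eta>_def[symmetric]
    proof (rule far)
      have "\<rho> \<le> frac (x y)" "frac (x y) < 1" using that by (auto simp: frac_lt_1)
      moreover have "\<eta> < real i / real H" "real i / real H < \<rho> - \<eta>"
        using that by (auto simp: B_def H_def[symmetric])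
      ultimately show "real i / real H - frac (x y) > \<eta> \<and> real i / real H - frac (x y) < 1 - \<eta> \<or>
          frac (x y) - real i / real H > \<eta> \<and> frac (x y) - real i / real H < 1 - \<eta>" by linarith
    qed
  qed (use \<rho> in auto)
  have "{..<N} = {y. y < N \<and> frac (x y) < \<rho>} \<union> {y. y < N \<and> \<rho> \<le> frac (x y)}" by auto
  moreover have "card ({y. y < N \<and> frac (x y) < \<rho>} \<union> {y. y < N \<and> \<rho> \<le> frac (x y)})
      = card {y. y < N \<and> frac (x y) < \<rho>} + card {y. y < N \<and> \<rho> \<le> frac (x y)}"
    by (intro card_Un_disjoint) auto
  ultimately have "N = card {y. y < N \<and> frac (x y) < \<rho>} + card {y. y < N \<and> \<rho> \<le> frac (x y)}"
    by (metis card_lessThan)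
  hence "real N = real (card {y. y < N \<and> frac (x y) < \<rho>}) + real (card {y. y < N \<and> \<rho> \<le> frac (x y)})"
    by (metis of_nat_add)
  moreover have "(1 - \<rho>) * real N = real N - \<rho> * real N" by (simp add: left_diff_distrib)
  ultimately show ?thesis using upper lower by linarith
qed

section \<open>Non-Liouville coefficients\<close>

text \<open>The fraction m/n is written as 2m/(2n), so that the condition \<open>q > 1\<close> holds
  even for \<open>n = 1\<close>.\<close>

lemma not_liouville_lower_bound:
  assumes "\<not> liouville \<alpha>"
  obtains n\<^sub>0 :: nat where "\<And>(n::nat) (m::int). 1 \<le> n \<Longrightarrow> 1 / real (2 * n) ^ n\<^sub>0 < \<bar>real n * \<alpha> - of_int m\<bar>"
proof -
  obtain n\<^sub>0 where n\<^sub>0: "\<And>p q :: int. 1 < q \<Longrightarrow> 1 / of_int q ^ n\<^sub>0 < \<bar>\<alpha> - of_int p / of_int q\<bar>"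
    using assms unfolding liouville_def by (meson not_le)
  show ?thesis
  proof (rule that)
    fix n :: nat and m :: int assume n: "1 \<le> n"
    have n2: "1 < int (2 * n)" using n by simp
    have "1 / real (2 * n) ^ n\<^sub>0 < \<bar>\<alpha> - of_int (2 * m) / of_int (int (2 * n))\<bar>"
      using n\<^sub>0[OF n2, of "2 * m"] by (simp only: of_int_of_nat_eq)
    also have "\<dots> = \<bar>\<alpha> - of_int m / real n\<bar>" by simp
    also have "\<dots> \<le> real n * \<bar>\<alpha> - of_int m / real n\<bar>"
      using n mult_right_mono[of 1 "real n"] by simp
    also have "\<dots> = \<bar>real n * (\<alpha> - of_int m / real n)\<bar>" by (simp add: abs_mult)
    also have "real n * (\<alpha> - of_int m / real n) = real n * \<alpha> - of_int m"
      using n by (simp add: right_diff_distrib)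
    finally show "1 / real (2 * n) ^ n\<^sub>0 < \<bar>real n * \<alpha> - of_int m\<bar>" .
  qed
qed

lemma not_liouville_exponential_sum_bound:
  assumes \<alpha>: "\<not> liouville \<alpha>"
  obtains C :: nat where
    "\<And>Q K N h. \<lbrakk>degree Q \<le> k; coeff Q 1 = \<alpha>; 2 \<le> K; K ^ C < real N; 1 \<le> h; real h \<le> K\<rbrakk>
      \<Longrightarrow> K * norm (\<Sum>y<N. ee (real h * poly Q (real y))) \<le> real N"
proof -
  obtain n\<^sub>0 where n\<^sub>0: "\<And>(n::nat) (m::int). 1 \<le> n \<Longrightarrow> 1 / real (2 * n) ^ n\<^sub>0 < \<bar>real n * \<alpha> - of_int m\<bar>"
    using not_liouville_lower_bound[OF \<alpha>] by blast
  \<comment> \<open>The bound \<open>Suc k\<close> meets the requirement of a positive degree bound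
    when \<open>k = 0\<close>.\<close>
  obtain C where C: "\<And>Q K N M. \<lbrakk>degree Q \<le> Suc k; 2 \<le> K; 1 \<le> N; M \<le> N;
        real N \<le> K * norm (\<Sum>y<M. ee (poly Q (real y)))\<rbrakk>
      \<Longrightarrow> \<exists>q::nat. \<exists>m::int. 1 \<le> q \<and> real q \<le> K ^ C \<and>
           \<bar>real q * coeff Q 1 - of_int m\<bar> \<le> K ^ C / real N"
    using exponential_sum_linear_coeff[of "Suc k"] by auto
  show ?thesis
  \<comment> \<open>The doubled denominator \<open>2 * (q * h)\<close> is at most
    \<open>K ^ (C + 2)\<close>. Its power \<open>n\<^sub>0\<close> in the lower bound, played
    against the error \<open>K ^ C / N\<close>, gives this exponent.\<close>
  proof (rule that[of "C + (C + 2) * n\<^sub>0"], rule ccontr)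
    fix Q :: "real poly" and K :: real and N h :: nat
    assume deg: "degree Q \<le> k" and Q1: "coeff Q 1 = \<alpha>" and K: "2 \<le> K"
      and N: "K ^ (C + (C + 2) * n\<^sub>0) < real N" and h: "1 \<le> h" "real h \<le> K"
      and "\<not> K * norm (\<Sum>y<N. ee (real h * poly Q (real y))) \<le> real N"
    hence large: "real N \<le> K * norm (\<Sum>y<N. ee (poly (smult (real h) Q) (real y)))" by simp
    have N0: "0 < real N" using N K by (smt (verit) zero_le_power)
    have "degree (smult (real h) Q) \<le> Suc k" using deg by (simp add: le_SucI)
    then obtain q m where q: "1 \<le> q" "real q \<le> K ^ C"
        "\<bar>real q * coeff (smult (real h) Q) 1 - of_int m\<bar> \<le> K ^ C / real N"
      using C[OF _ K _ order.refl large] N0 by auto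
    have "1 / (K ^ (C + 2)) ^ n\<^sub>0 \<le> 1 / real (2 * (q * h)) ^ n\<^sub>0"
    proof (intro divide_left_mono power_mono)
      have "2 * (real q * real h) \<le> K * (K ^ C * K)"
        using q h K by (intro mult_mono) auto
      thus "real (2 * (q * h)) \<le> K ^ (C + 2)" by (simp add: mult_ac)
    qed (use q h K in auto)
    also have "\<dots> < \<bar>real (q * h) * \<alpha> - of_int m\<bar>" using q h by (intro n\<^sub>0) auto
    also have "\<dots> \<le> K ^ C / real N" using q(3) Q1 by (simp add: mult.assoc)
    finally have "real N < K ^ C * (K ^ (C + 2)) ^ n\<^sub>0"
      using N0 K by (simp add: field_simps)
    also have "\<dots> = K ^ (C + (C + 2) * n\<^sub>0)" by (simp only: power_add power_mult)
    finally show False using N by simp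
  qed
qed

lemma polynomial_frac_count:
  assumes \<alpha>: "\<not> liouville \<alpha>"
  obtains s :: nat where "1 \<le> s"
    "\<And>Q N \<rho>. \<lbrakk>degree Q \<le> k; coeff Q 1 = \<alpha>; 0 \<le> \<rho>; \<rho> \<le> 1; 2 ^ s \<le> real N\<rbrakk>
      \<Longrightarrow> \<bar>real (card {y. y < N \<and> frac (poly Q (real y)) < \<rho>}) - \<rho> * real N\<bar>
          \<le> 20 * real N powr (1 - 1 / real s)"
proof -
  obtain C where C: "\<And>Q K N h. \<lbrakk>degree Q \<le> k; coeff Q 1 = \<alpha>; 2 \<le> K; K ^ C < real N; 1 \<le> h; real h \<le> K\<rbrakk>
      \<Longrightarrow> K * norm (\<Sum>y<N. ee (real h * poly Q (real y))) \<le> real N"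
    using not_liouville_exponential_sum_bound[OF \<alpha>, of k] by blast
  \<comment> \<open>With \<open>G\<close> about the \<open>s\<close>-th root of \<open>N\<close>,
    this makes \<open>(G ^ 4) ^ C < G ^ s \<le> N\<close>, so the exponential sum bound holds with
    \<open>K = G ^ 4\<close>, which exceeds all the frequencies \<open>l < G ^ 3\<close>.\<close>
  define s where "s = 4 * C + 1"
  show ?thesis
  proof (rule that)
    show "1 \<le> s" by (simp add: s_def)
    fix Q :: "real poly" and N :: nat and \<rho> :: real
    assume Q: "degree Q \<le> k" "coeff Q 1 = \<alpha>" and \<rho>: "0 \<le> \<rho>" "\<rho> \<le> 1" and N: "2 ^ s \<le> real N"
    have N0: "0 < real N" using N by (smt (verit) zero_less_power)
    define r where "r = real N powr (1 / real s)"
    have "s \<noteq> 0" by (simp add: s_def)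
    hence rs: "r ^ s = real N"
      using N0 by (simp add: r_def powr_realpow[symmetric] powr_powr)
    have r: "2 \<le> r"
    proof (rule ccontr)
      assume "\<not> 2 \<le> r"
      hence "r ^ s < 2 ^ s" by (intro power_strict_mono) (auto simp: r_def s_def)
      thus False using rs N by simp
    qed
    define G where "G = nat \<lfloor>r\<rfloor>"
    have G: "2 \<le> G" "real G \<le> r" "r < real G + 1"
      using r unfolding G_def by linarith+
    have "(real G ^ 4) ^ C < real G ^ s"
      using G by (simp add: s_def power_mult[symmetric])
    also have "\<dots> \<le> real N" using power_mono[OF G(2), of s] by (simp add: rs)
    finally have GN: "(real G ^ 4) ^ C < real N" .
    have "2 ^ 1 \<le> real G ^ 4" using G by (intro order.trans[OF power_increasing[of 1 4 2] power_mono]) auto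
    hence G4: "2 \<le> real G ^ 4" by simp
    have "\<bar>real (card {y. y < N \<and> frac (poly Q (real y)) < \<rho>}) - \<rho> * real N\<bar> \<le> 10 * (real N / real G)"
    proof (rule frac_count_discrepancy[OF G(1) \<rho>])
      fix l :: nat assume l: "1 \<le> l" "l < G ^ 3"
      have "G ^ 3 \<le> G ^ 4" using G by (intro power_increasing) auto
      hence "real l \<le> real (G ^ 4)" using l by linarith
      hence "real G ^ 4 * norm (\<Sum>y<N. ee (real l * poly Q (real y))) \<le> real N"
        using C[OF Q G4 GN l(1)] by simp
      thus "norm (\<Sum>y<N. ee (real l * poly Q (real y))) \<le> real N / real G ^ 4"
        using G by (simp add: field_simps)
    qed
    also have "real N / real G \<le> real N / (r / 2)"
      using G r by (intro divide_left_mono) auto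
    also have "10 * \<dots> = 20 * (real N / r)" by simp
    also have "real N / r = real N powr (1 - 1 / real s)"
      using N0 by (simp add: r_def powr_diff)
    finally show "\<bar>real (card {y. y < N \<and> frac (poly Q (real y)) < \<rho>}) - \<rho> * real N\<bar>
        \<le> 20 * real N powr (1 - 1 / real s)" by simp
  qed
qed

section \<open>From the gcd count to fractional parts\<close>

lemma dvd_floor_iff_frac:
  assumes "1 \<le> d"
  shows "int d dvd \<lfloor>z\<rfloor> \<longleftrightarrow> frac (z / real d) < 1 / real d"
proof -
  have d: "0 < real d" using assms by simp
  have "int d dvd \<lfloor>z\<rfloor> \<longleftrightarrow> (\<exists>m. \<lfloor>z\<rfloor> = int d * m)" by (auto simp: dvd_def)
  \<comment> \<open>The floor of \<open>z\<close> is \<open>d * m\<close> exactly when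
    \<open>z\<close> lies in [dm, dm + 1); divide by \<open>d\<close>.\<close>
  also have "\<dots> \<longleftrightarrow> (\<exists>m::int. of_int m \<le> z / real d \<and> z / real d < of_int m + 1 / real d)"
    using d by (simp add: floor_eq_iff field_simps)
  also have "\<dots> \<longleftrightarrow> frac (z / real d) < 1 / real d"
  proof
    assume "\<exists>m::int. of_int m \<le> z / real d \<and> z / real d < of_int m + 1 / real d"
    then obtain m :: int where m: "of_int m \<le> z / real d" "z / real d < of_int m + 1 / real d" by blast
    have "1 / real d \<le> 1" using assms by simp
    hence "\<lfloor>z / real d\<rfloor> = m" using m by (intro floor_unique) auto
    thus "frac (z / real d) < 1 / real d" using m by (simp add: frac_def)
  next
    assume "frac (z / real d) < 1 / real d"
    thus "\<exists>m::int. of_int m \<le> z / real d \<and> z / real d < of_int m + 1 / real d"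
      by (intro exI[of _ "\<lfloor>z / real d\<rfloor>"]) (auto simp: frac_def)
  qed
  finally show ?thesis .
qed

lemma gcd_count_eq:
  assumes d: "1 \<le> d"
  shows "gcd_count P d X = card {y. 1 \<le> y \<and> real y \<le> X / real d \<and> frac (poly P (real (d * y)) / real d) < 1 / real d}"
proof -
  define S where "S = {y. 1 \<le> y \<and> real y \<le> X / real d \<and> frac (poly P (real (d * y)) / real d) < 1 / real d}"
  have eq: "{x::nat. x \<ge> 1 \<and> real x \<le> X \<and> int d dvd gcd (int x) \<lfloor>poly P (real x)\<rfloor>} = (\<lambda>y. d * y) ` S"
  proof (intro equalityI subsetI)
    fix x assume "x \<in> {x::nat. x \<ge> 1 \<and> real x \<le> X \<and> int d dvd gcd (int x) \<lfloor>poly P (real x)\<rfloor>}"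
    hence x: "1 \<le> x" "real x \<le> X" "d dvd x" "int d dvd \<lfloor>poly P (real x)\<rfloor>" by auto
    then obtain y where y: "x = d * y" by (auto elim: dvdE)
    have "y \<in> S" unfolding S_def mem_Collect_eq dvd_floor_iff_frac[OF d, symmetric]
      using x y d by (auto simp: field_simps Suc_le_eq)
    thus "x \<in> (\<lambda>y. d * y) ` S" using y by blast
  next
    fix x assume "x \<in> (\<lambda>y. d * y) ` S"
    then obtain y where y: "x = d * y" "y \<in> S" by blast
    have "1 \<le> y" "real y \<le> X / real d" "int d dvd \<lfloor>poly P (real (d * y))\<rfloor>"
      using y(2) unfolding S_def mem_Collect_eq dvd_floor_iff_frac[OF d] by auto
    thus "x \<in> {x::nat. x \<ge> 1 \<and> real x \<le> X \<and> int d dvd gcd (int x) \<lfloor>poly P (real x)\<rfloor>}"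
      using d y(1) by (auto simp: field_simps Suc_le_eq)
  qed
  have "inj_on (\<lambda>y. d * y) S" using d by (auto intro: inj_onI)
  thus ?thesis unfolding gcd_count_def eq S_def[symmetric] by (rule card_image)
qed

theorem theorem4p1:
  fixes P :: "real poly"
  assumes "\<not> liouville (coeff P 1)"
  shows "\<exists>\<mu> C C\<^sub>0 :: real. \<mu> > 0 \<and> C > 0 \<and> C\<^sub>0 > 0 \<and>
           (\<forall>(d::nat) (X::real). d \<ge> 1 \<longrightarrow> X > 0 \<longrightarrow> X / real d > C \<longrightarrow>
              \<bar>real (gcd_count P d X) - X / (real d)\<^sup>2\<bar> \<le> C\<^sub>0 * (X / real d) powr (1 - \<mu>))"
proof -
  obtain s where s: "1 \<le> s" and equi:
    "\<And>Q N \<rho>. \<lbrakk>degree Q \<le> degree P; coeff Q 1 = coeff P 1; 0 \<le> \<rho>; \<rho> \<le> 1; 2 ^ s \<le> real N\<rbrakk>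
      \<Longrightarrow> \<bar>real (card {y. y < N \<and> frac (poly Q (real y)) < \<rho>}) - \<rho> * real N\<bar>
          \<le> 20 * real N powr (1 - 1 / real s)"
    using polynomial_frac_count[OF assms, of "degree P"] by blast
  \<comment> \<open>The constant 42 is 20 * 2, as \<open>N\<close> is at most twice X/d, plus 1 for
    the term \<open>y = 0\<close> and 1 for replacing \<open>N\<close> by X/d.\<close>
  have "\<bar>real (gcd_count P d X) - X / (real d)\<^sup>2\<bar> \<le> 42 * (X / real d) powr (1 - 1 / real s)"
    if d: "1 \<le> d" and X: "2 ^ s < X / real d" for d :: nat and X :: real
  proof -
    define Y where "Y = X / real d"
    \<comment> \<open>With this \<open>N\<close>, \<open>y < N\<close> is equivalent to
      \<open>y \<le> Y\<close> for natural \<open>y\<close>.\<close>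
    define N where "N = nat \<lfloor>Y\<rfloor> + 1"
    define \<rho> where "\<rho> = 1 / real d"
    define Q where "Q = smult (1 / real d) (pcompose P [:0, real d:])"
    define W where "W = {y. y < N \<and> frac (poly Q (real y)) < \<rho>}"
    have \<rho>: "0 \<le> \<rho>" "\<rho> \<le> 1" using d by (auto simp: \<rho>_def)
    have "1 \<le> (2::real) ^ s" by simp
    hence Y1: "1 \<le> Y" using X unfolding Y_def by linarith
    have N: "real N \<le> Y + 1" "Y < real N" using Y1 unfolding N_def by linarith+
    have degQ: "degree Q \<le> degree P" using d by (simp add: Q_def degree_pcompose)
    have Q1: "coeff Q 1 = coeff P 1"
      using d by (simp add: Q_def coeff_pcompose_linear)
    have polyQ: "poly Q (real y) = poly P (real (d * y)) / real d" for y
      by (simp add: Q_def poly_pcompose mult.commute)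
    have e1: "0 \<le> 1 - 1 / real s" "1 - 1 / real s \<le> 1" using s by auto
    have 1: "\<bar>real (card W) - \<rho> * real N\<bar> \<le> 20 * real N powr (1 - 1 / real s)"
    proof -
      have "2 ^ s \<le> real N" using X N unfolding Y_def by linarith
      thus ?thesis unfolding W_def by (intro equi degQ Q1 \<rho>)
    qed
    \<comment> \<open>\<open>W\<close> may contain \<open>y = 0\<close>, which the gcd count
      excludes; otherwise the two sets agree.\<close>
    have 2: "\<bar>real (gcd_count P d X) - real (card W)\<bar> \<le> 1"
    proof -
      define V where "V = {y. 1 \<le> y \<and> real y \<le> Y \<and> frac (poly Q (real y)) < \<rho>}"
      have "gcd_count P d X = card V"
        by (simp only: gcd_count_eq[OF d] V_def Y_def polyQ \<rho>_def)
      moreover have VW: "V \<subseteq> W" "W \<subseteq> insert 0 V"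
      proof -
        have "y < N" if "real y \<le> Y" for y using that N by linarith
        thus "V \<subseteq> W" by (auto simp: V_def W_def)
        have "real y \<le> Y" if "y < N" for y using that N by linarith
        thus "W \<subseteq> insert 0 V" by (auto simp: V_def W_def)
      qed
      moreover have "finite W" by (simp add: W_def)
      moreover have "finite V" using VW(1) \<open>finite W\<close> by (rule finite_subset)
      moreover have "card V \<le> card W" using VW(1) \<open>finite W\<close> by (intro card_mono)
      moreover have "card W \<le> card (insert 0 V)" using VW(2) \<open>finite V\<close> by (intro card_mono) auto
      moreover have "card (insert 0 V) \<le> Suc (card V)" by (rule card_insert_le_m1) auto
      ultimately show ?thesis by linarith
    qed
    have 3: "\<bar>\<rho> * real N - \<rho> * Y\<bar> \<le> 1"
    proof -
      have "\<bar>\<rho> * real N - \<rho> * Y\<bar> = \<rho> * (real N - Y)"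
        using N \<rho> by (simp add: right_diff_distrib[symmetric] abs_mult)
      also have "\<dots> \<le> 1 * 1" using N \<rho> by (intro mult_mono) auto
      finally show ?thesis by simp
    qed
    have 4: "real N powr (1 - 1 / real s) \<le> 2 * Y powr (1 - 1 / real s)"
    proof -
      have "real N powr (1 - 1 / real s) \<le> (2 * Y) powr (1 - 1 / real s)"
        using N Y1 e1 by (intro powr_mono2) auto
      also have "\<dots> = 2 powr (1 - 1 / real s) * Y powr (1 - 1 / real s)"
        using Y1 by (simp add: powr_mult)
      also have "\<dots> \<le> 2 * Y powr (1 - 1 / real s)"
        using powr_mono[OF e1(2), of 2] by (intro mult_right_mono) auto
      finally show ?thesis .
    qed
    have 5: "1 \<le> Y powr (1 - 1 / real s)" using Y1 e1 by (intro ge_one_powr_ge_zero) auto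
    have "X / (real d)\<^sup>2 = \<rho> * Y" by (simp add: \<rho>_def Y_def power2_eq_square)
    thus ?thesis unfolding Y_def[symmetric] using 1 2 3 4 5 by linarith
  qed
  thus ?thesis using s by (intro exI[of _ "1 / real s"] exI[of _ "2 ^ s"] exI[of _ 42]) auto
qed

end
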